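(* Let $X$ be a topological space, let $\Bbbk$ be a field, and let $a \in H^*(X;\Bbbk)$ be a homogeneous cohomology class. For $n \geq 2$ we have $$(a_1-a_2)(a_1-a_3) \cdots (a_1 -a_n) \equiv (-1)^n(a \otimes 1-1 \otimes a) \otimes a \otimes \cdots \otimes a$$ modulo terms in the ideal of $H^*(X;\Bbbk)^{\otimes n}$ generated by the elements $a^2 \otimes 1 \otimes \cdots \otimes 1$ and $a \otimes a \otimes 1 \otimes \cdots \otimes 1$.
   Context: $H^*(X;\Bbbk)$ is the cohomology ring of $X$ with coefficients in $\Bbbk$, a graded-commutative $\Bbbk$-algebra under cup product. $H^*(X;\Bbbk)^{\otimes n}$ denotes the $n$-fold tensor product of $H^*(X;\Bbbk)$ over $\Bbbk$, equipped with the graded product, determined on homogeneous elements by the Koszul sign rule: $(x_1 \otimes \cdots \otimes x_n)(y_1 \otimes \cdots \otimes y_n) = (-1)^{\sum_{i>j} |x_i||y_j|}\, x_1y_1 \otimes \cdots \otimes x_ny_n$, where $|x|$ is the degree of $x$. For $1 \le i \le n$, $a_i$ denotes the element $1 \otimes \cdots \otimes 1 \otimes a \otimes 1 \otimes \cdots \otimes 1$ of $H^*(X;\Bbbk)^{\otimes n}$ with $a$ in the $i$-th position. In the right-hand side of the congruence, the factor in parentheses occupies the first two tensor positions and the remaining $n-2$ positions are all $a$ (for $n=2$ there are no remaining positions). The displayed generators of the ideal are elements of $H^*(X;\Bbbk)^{\otimes n}$, with the entries not shown equal to $1$. *)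

theory Defs
  imports "HOL-Homology.Homology" "HOL-Algebra.QuotRing" "HOL-Algebra.Module"
begin

text \<open>
  Coefficients are a type \<open>'k::field\<close>. A cochain takes as arguments a degree and a singular simplex;
  cochains of all degrees are collected in the direct sum \<open>C\<^sup>*(X; k) = \<Oplus>\<^sub>p C\<^sup>p(X; k)\<close>. Values at
  anything that is not a singular simplex of the given degree are normalised to 0.
\<close>

type_synonym ('a, 'k) cochain = "nat \<Rightarrow> ((nat \<Rightarrow> real) \<Rightarrow> 'a) \<Rightarrow> 'k"

definition singular_cochains :: "'a topology \<Rightarrow> ('a, 'k::field) cochain set" where
  "singular_cochains X =
     {c. (\<forall>p f. \<not> singular_simplex p X f \<longrightarrow> c p f = 0) \<and> finite {p. \<exists>f. c p f \<noteq> 0}}"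

definition singular_coboundary :: "'a topology \<Rightarrow> ('a, 'k::field) cochain \<Rightarrow> ('a, 'k) cochain" where
  "singular_coboundary X c = (\<lambda>p f.
     if 0 < p \<and> singular_simplex p X f
     then \<Sum>i\<le>p. (-1) ^ i * c (p - 1) (singular_face p i f) else 0)"

definition front_face :: "nat \<Rightarrow> ((nat \<Rightarrow> real) \<Rightarrow> 'a) \<Rightarrow> (nat \<Rightarrow> real) \<Rightarrow> 'a" where
  "front_face p f = restrict f (standard_simplex p)"

text \<open>The restriction of a \<open>(p + q)\<close>-simplex to the face spanned by the vertices \<open>p, \<dots>, p + q\<close>:\<close>

definition back_face :: "nat \<Rightarrow> nat \<Rightarrow> ((nat \<Rightarrow> real) \<Rightarrow> 'a) \<Rightarrow> (nat \<Rightarrow> real) \<Rightarrow> 'a" where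
  "back_face p q f =
     restrict (\<lambda>x. f (\<lambda>i. if i < p then 0 else x (i - p))) (standard_simplex q)"

definition cup_cochain ::
  "'a topology \<Rightarrow> ('a, 'k::field) cochain \<Rightarrow> ('a, 'k) cochain \<Rightarrow> ('a, 'k) cochain" where
  "cup_cochain X c d = (\<lambda>n f.
     if singular_simplex n X f
     then \<Sum>p\<le>n. c p (front_face p f) * d (n - p) (back_face p (n - p) f) else 0)"

definition cochain_ring :: "'a topology \<Rightarrow> ('a, 'k::field) cochain ring" where
  "cochain_ring X =
     \<lparr>carrier = singular_cochains X,
      mult = cup_cochain X,
      one = (\<lambda>p f. if p = 0 \<and> singular_simplex 0 X f then 1 else 0),
      zero = (\<lambda>p f. 0),
      add = (\<lambda>c d p f. c p f + d p f)\<rparr>"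

definition singular_cocycles :: "'a topology \<Rightarrow> ('a, 'k::field) cochain set" where
  "singular_cocycles X = {c \<in> singular_cochains X. singular_coboundary X c = (\<lambda>p f. 0)}"

definition cocycle_ring :: "'a topology \<Rightarrow> ('a, 'k::field) cochain ring" where
  "cocycle_ring X = (cochain_ring X)\<lparr>carrier := singular_cocycles X\<rparr>"

definition singular_coboundaries :: "'a topology \<Rightarrow> ('a, 'k::field) cochain set" where
  "singular_coboundaries X = singular_coboundary X ` singular_cochains X"

definition cohomology_class :: "'a topology \<Rightarrow> ('a, 'k::field) cochain \<Rightarrow> ('a, 'k) cochain set" where
  "cohomology_class X z = singular_coboundaries X +>\<^bsub>cocycle_ring X\<^esub> z"

definition cohomology_group :: "'a topology \<Rightarrow> nat \<Rightarrow> ('a, 'k::field) cochain set set" where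
  "cohomology_group X p =
     {cohomology_class X z | z. z \<in> singular_cocycles X \<and> (\<forall>q f. q \<noteq> p \<longrightarrow> z q f = 0)}"

text \<open>
  A graded algebra is a ring with a scalar multiplication, together with the projections
  \<open>component A p\<close> of \<open>A = \<Oplus>\<^sub>p A\<^sup>p\<close> onto its homogeneous parts.
\<close>

record ('k, 'h) graded_algebra = "('k, 'h) module" +
  component :: "nat \<Rightarrow> 'h \<Rightarrow> 'h"

definition cohomology_algebra ::
  "'a topology \<Rightarrow> ('k::field, ('a, 'k) cochain set) graded_algebra" where
  "cohomology_algebra X =
     (let Q = cocycle_ring X Quot singular_coboundaries X in
     \<lparr>carrier = carrier Q, mult = mult Q, one = one Q, zero = zero Q, add = add Q,
      smult = (\<lambda>r A. \<Union>z\<in>A. cohomology_class X (\<lambda>p f. r * z p f)),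
      component = (\<lambda>p A. \<Union>z\<in>A. cohomology_class X (\<lambda>q f. if q = p then z q f else 0))\<rparr>)"

text \<open>
  The \<open>n\<close>-fold tensor product of \<open>A\<close> is the quotient of the vector space with basis the \<open>n\<close>-tuples
  of elements of \<open>A\<close> (functions on \<open>{1..n}\<close>) by the multilinearity relations. The Koszul
  sign rule for homogeneous tuples is extended to all tuples by splitting every entry into its
  homogeneous components, and then bilinearly to linear combinations of tuples.
\<close>

type_synonym ('k, 'h) tuple_comb = "(nat \<Rightarrow> 'h) \<Rightarrow>\<^sub>0 'k"

definition tuples :: "nat \<Rightarrow> ('k, 'h) graded_algebra \<Rightarrow> (nat \<Rightarrow> 'h) set" where
  "tuples n A = (\<Pi>\<^sub>E i\<in>{1..n}. carrier A)"

abbreviation scale_comb :: "'k::field \<Rightarrow> ('k, 'h) tuple_comb \<Rightarrow> ('k, 'h) tuple_comb" where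
  "scale_comb r u \<equiv> Poly_Mapping.map ((*) r) u"

abbreviation tuple_vec :: "(nat \<Rightarrow> 'h) \<Rightarrow> ('k::field, 'h) tuple_comb" where
  "tuple_vec x \<equiv> Poly_Mapping.single x 1"

definition multidegrees ::
  "nat \<Rightarrow> ('k, 'h) graded_algebra \<Rightarrow> (nat \<Rightarrow> 'h) \<Rightarrow> (nat \<Rightarrow> nat) set" where
  "multidegrees n A x =
     {p \<in> {1..n} \<rightarrow>\<^sub>E UNIV. \<forall>i\<in>{1..n}. component A (p i) (x i) \<noteq> \<zero>\<^bsub>A\<^esub>}"

definition koszul_tuple ::
  "nat \<Rightarrow> ('k::field, 'h) graded_algebra \<Rightarrow> (nat \<Rightarrow> 'h) \<Rightarrow> (nat \<Rightarrow> 'h) \<Rightarrow> ('k, 'h) tuple_comb" where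
  "koszul_tuple n A x y =
     (\<Sum>p\<in>multidegrees n A x. \<Sum>q\<in>multidegrees n A y.
        scale_comb ((-1) ^ (\<Sum>i\<in>{1..n}. \<Sum>j\<in>{1..<i}. p i * q j))
          (tuple_vec (\<lambda>i\<in>{1..n}. component A (p i) (x i) \<otimes>\<^bsub>A\<^esub> component A (q i) (y i))))"

definition bilinear_extension ::
  "((nat \<Rightarrow> 'h) \<Rightarrow> (nat \<Rightarrow> 'h) \<Rightarrow> ('k::field, 'h) tuple_comb) \<Rightarrow>
     ('k, 'h) tuple_comb \<Rightarrow> ('k, 'h) tuple_comb \<Rightarrow> ('k, 'h) tuple_comb" where
  "bilinear_extension m u v =
     (\<Sum>x\<in>Poly_Mapping.keys u. \<Sum>y\<in>Poly_Mapping.keys v.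
        scale_comb (Poly_Mapping.lookup u x * Poly_Mapping.lookup v y) (m x y))"

text \<open>
  Only the quotient of the following structure by the multilinearity relations is a ring: before
  passing to the quotient, multiplication by \<open>one\<close> merely splits the entries into components.
\<close>

definition free_tensors ::
  "nat \<Rightarrow> ('k::field, 'h) graded_algebra \<Rightarrow> ('k, 'h) tuple_comb ring" where
  "free_tensors n A =
     \<lparr>carrier = {u. Poly_Mapping.keys u \<subseteq> tuples n A},
      mult = bilinear_extension (koszul_tuple n A),
      one = tuple_vec (\<lambda>i\<in>{1..n}. \<one>\<^bsub>A\<^esub>),
      zero = 0,
      add = (+)\<rparr>"

definition multilinear_relations ::
  "nat \<Rightarrow> ('k::field, 'h) graded_algebra \<Rightarrow> ('k, 'h) tuple_comb set" where
  "multilinear_relations n A = module.span scale_comb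
     ({tuple_vec (x(i := b \<oplus>\<^bsub>A\<^esub> c)) - tuple_vec (x(i := b)) - tuple_vec (x(i := c)) | x i b c.
         x \<in> tuples n A \<and> i \<in> {1..n} \<and> b \<in> carrier A \<and> c \<in> carrier A} \<union>
      {tuple_vec (x(i := r \<odot>\<^bsub>A\<^esub> b)) - scale_comb r (tuple_vec (x(i := b))) | x i r b.
         x \<in> tuples n A \<and> i \<in> {1..n} \<and> b \<in> carrier A})"

definition tensor_power ::
  "nat \<Rightarrow> ('k::field, 'h) graded_algebra \<Rightarrow> ('k, 'h) tuple_comb set ring" where
  "tensor_power n A = free_tensors n A Quot multilinear_relations n A"

definition tensor_class ::
  "nat \<Rightarrow> ('k::field, 'h) graded_algebra \<Rightarrow> ('k, 'h) tuple_comb \<Rightarrow> ('k, 'h) tuple_comb set" where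
  "tensor_class n A u = multilinear_relations n A +>\<^bsub>free_tensors n A\<^esub> u"

definition pure_tensor ::
  "nat \<Rightarrow> ('k::field, 'h) graded_algebra \<Rightarrow> (nat \<Rightarrow> 'h) \<Rightarrow> ('k, 'h) tuple_comb set" where
  "pure_tensor n A x = tensor_class n A (tuple_vec (restrict x {1..n}))"

definition in_position ::
  "nat \<Rightarrow> ('k::field, 'h) graded_algebra \<Rightarrow> 'h \<Rightarrow> nat \<Rightarrow> ('k, 'h) tuple_comb set" where
  "in_position n A a i = pure_tensor n A (\<lambda>j. if j = i then a else \<one>\<^bsub>A\<^esub>)"

text \<open>
  Juxtaposition \<open>A\<^sup>\<otimes>\<^sup>m \<times> A\<^sup>\<otimes>\<^sup>n \<rightarrow> A\<^sup>\<otimes>\<^sup>m\<^sup>+\<^sup>n\<close>, \<open>(x\<^sub>1 \<otimes> \<dots> \<otimes> x\<^sub>m, y\<^sub>1 \<otimes> \<dots> \<otimes> y\<^sub>n) \<mapsto>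
  x\<^sub>1 \<otimes> \<dots> \<otimes> x\<^sub>m \<otimes> y\<^sub>1 \<otimes> \<dots> \<otimes> y\<^sub>n\<close>, for which there is no sign.
\<close>

definition juxtapose ::
  "nat \<Rightarrow> nat \<Rightarrow> ('k::field, 'h) graded_algebra \<Rightarrow>
     ('k, 'h) tuple_comb set \<Rightarrow> ('k, 'h) tuple_comb set \<Rightarrow> ('k, 'h) tuple_comb set" where
  "juxtapose m n A P Q =
     (\<Union>u\<in>P. \<Union>v\<in>Q. tensor_class (m + n) A (bilinear_extension
        (\<lambda>x y. tuple_vec (\<lambda>i\<in>{1..m + n}. if i \<le> m then x i else y (i - m))) u v))"

end

theory Submission
  imports Defs
begin

text \<open>
  Write \<open>x\<close> for \<open>a\<^sub>1\<close>. Since \<open>a\<^sub>j x = \<plusminus>x a\<^sub>j\<close>, every term of the expanded product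
  \<open>(x - a\<^sub>3) \<dots> (x - a\<^sub>n)\<close> that contains a factor \<open>x\<close> is of the form \<open>x s\<close>, so this product
  is \<open>(-1)\<^sup>n a\<^sub>3 \<dots> a\<^sub>n + x s\<close>. Multiplying by \<open>x - a\<^sub>2\<close> on the left, the error term becomes
  \<open>x\<^sup>2 s - a\<^sub>2 x s\<close>, which lies in the ideal generated by \<open>x\<^sup>2\<close> and \<open>x a\<^sub>2 = \<plusminus>a\<^sub>2 x\<close>; and
  \<open>x a\<^sub>3 \<dots> a\<^sub>n\<close>, \<open>a\<^sub>2 a\<^sub>3 \<dots> a\<^sub>n\<close> are the pure tensors of the right-hand side, without sign
  because their factors occur in increasing order.

  In HOL-Algebra an ideal comes with the ring axioms of the ambient structure, and \<open>Idl S\<close> is the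
  intersection of all ideals containing \<open>S\<close>. Membership therefore has to be shown only for a given
  ideal, whose existence provides that the tensor power is a ring. In particular its
  multiplication is closed, and that makes the products that occur below well defined on classes,
  both in the tensor power and in the cohomology algebra.
\<close>

section \<open>Tensor powers of graded algebras\<close>

lemma lookup_scale_comb [simp]: "Poly_Mapping.lookup (scale_comb r u) x = r * Poly_Mapping.lookup u x"
  by (simp add: Poly_Mapping.map.rep_eq when_def)

interpretation comb: vector_space "scale_comb :: 'k::field \<Rightarrow> ('k, 'h) tuple_comb \<Rightarrow> _"
  by unfold_locales (auto intro!: poly_mapping_eqI simp: lookup_add algebra_simps)

lemma keys_scale_comb: "Poly_Mapping.keys (scale_comb r u) \<subseteq> Poly_Mapping.keys u"
  by (auto simp: in_keys_iff)

text \<open>Keys outside the support have coefficient 0. A common finite index set is needed because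
  the supports of \<open>u\<close>, \<open>u'\<close> and \<open>u + u'\<close> differ, so that
  linearity cannot be checked term by term on the sums over keys.\<close>

lemma bilinear_extension_superset:
  assumes "finite K" "Poly_Mapping.keys u \<subseteq> K" "finite L" "Poly_Mapping.keys v \<subseteq> L"
  shows "bilinear_extension m u v = (\<Sum>x\<in>K. \<Sum>y\<in>L.
    scale_comb (Poly_Mapping.lookup u x * Poly_Mapping.lookup v y) (m x y))"
proof -
  have "(\<Sum>y\<in>Poly_Mapping.keys v. scale_comb (Poly_Mapping.lookup u x * Poly_Mapping.lookup v y) (m x y))
      = (\<Sum>y\<in>L. scale_comb (Poly_Mapping.lookup u x * Poly_Mapping.lookup v y) (m x y))" for x
    by (intro sum.mono_neutral_left) (use assms in \<open>auto simp: in_keys_iff\<close>)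
  then have "bilinear_extension m u v = (\<Sum>x\<in>Poly_Mapping.keys u. \<Sum>y\<in>L.
      scale_comb (Poly_Mapping.lookup u x * Poly_Mapping.lookup v y) (m x y))"
    by (simp add: bilinear_extension_def)
  also have "\<dots> = (\<Sum>x\<in>K. \<Sum>y\<in>L.
      scale_comb (Poly_Mapping.lookup u x * Poly_Mapping.lookup v y) (m x y))"
    using assms(1,2) by (rule sum.mono_neutral_left) (auto simp: in_keys_iff)
  finally show ?thesis .
qed

lemma linear_bilinear_extension_left:
  fixes m :: "(nat \<Rightarrow> 'h) \<Rightarrow> (nat \<Rightarrow> 'h) \<Rightarrow> ('k::field, 'h) tuple_comb"
  shows "Vector_Spaces.linear scale_comb scale_comb (\<lambda>u. bilinear_extension m u v)"
proof (unfold_locales)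
  fix u u' :: "('k, 'h) tuple_comb" and r
  let ?K = "Poly_Mapping.keys u \<union> Poly_Mapping.keys u'"
  have "Poly_Mapping.keys (u + u') \<subseteq> ?K"
    by (rule keys_add)
  then show "bilinear_extension m (u + u') v = bilinear_extension m u v + bilinear_extension m u' v"
    by (simp add: bilinear_extension_superset[of ?K _ "Poly_Mapping.keys v"] lookup_add
        distrib_right comb.scale_left_distrib sum.distrib)
  show "bilinear_extension m (scale_comb r u) v = scale_comb r (bilinear_extension m u v)"
    using keys_scale_comb[of r u]
    by (simp add: bilinear_extension_superset[of "Poly_Mapping.keys u" _ "Poly_Mapping.keys v"]
        comb.scale_sum_right mult.assoc)
qed

lemma linear_bilinear_extension_right:
  fixes m :: "(nat \<Rightarrow> 'h) \<Rightarrow> (nat \<Rightarrow> 'h) \<Rightarrow> ('k::field, 'h) tuple_comb"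
  shows "Vector_Spaces.linear scale_comb scale_comb (bilinear_extension m u)"
proof (unfold_locales)
  fix v v' :: "('k, 'h) tuple_comb" and r
  let ?L = "Poly_Mapping.keys v \<union> Poly_Mapping.keys v'"
  have "Poly_Mapping.keys (v + v') \<subseteq> ?L"
    by (rule keys_add)
  then show "bilinear_extension m u (v + v') = bilinear_extension m u v + bilinear_extension m u v'"
    by (simp add: bilinear_extension_superset[of "Poly_Mapping.keys u" _ ?L] lookup_add
        distrib_left comb.scale_left_distrib sum.distrib)
  show "bilinear_extension m u (scale_comb r v) = scale_comb r (bilinear_extension m u v)"
    using keys_scale_comb[of r v]
    by (simp add: bilinear_extension_superset[of "Poly_Mapping.keys u" _ "Poly_Mapping.keys v"]
        comb.scale_sum_right mult.assoc mult.left_commute)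
qed

lemma bilinear_extension_tuple_vec [simp]:
  "bilinear_extension m (tuple_vec x) (tuple_vec y) = m x y"
  by (simp add: bilinear_extension_def)

text \<open>The preimage of a subspace under a linear map is a subspace, so membership in
  \<open>V\<close> need only be tested on generators. This is applied to the generators of the
  multilinearity relations.\<close>

lemma bilinear_extension_span_left:
  assumes "u \<in> comb.span S" "comb.subspace V" "\<And>s. s \<in> S \<Longrightarrow> bilinear_extension m s v \<in> V"
  shows "bilinear_extension m u v \<in> V"
proof -
  interpret Vector_Spaces.linear scale_comb scale_comb "\<lambda>u. bilinear_extension m u v"
    by (rule linear_bilinear_extension_left)
  from assms(1) have "u \<in> {u. bilinear_extension m u v \<in> V}"
    by (rule comb.span_induct) (use assms in \<open>auto intro: subspace_linear_preimage\<close>)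
  then show ?thesis
    by simp
qed

lemma bilinear_extension_span_right:
  assumes "v \<in> comb.span S" "comb.subspace V" "\<And>s. s \<in> S \<Longrightarrow> bilinear_extension m u s \<in> V"
  shows "bilinear_extension m u v \<in> V"
proof -
  interpret Vector_Spaces.linear scale_comb scale_comb "bilinear_extension m u"
    by (rule linear_bilinear_extension_right)
  from assms(1) have "v \<in> {v. bilinear_extension m u v \<in> V}"
    by (rule comb.span_induct) (use assms in \<open>auto intro: subspace_linear_preimage\<close>)
  then show ?thesis
    by simp
qed

section \<open>Cosets of the multilinearity relations\<close>

lemma subspace_multilinear_relations: "comb.subspace (multilinear_relations n A)"
  by (simp add: multilinear_relations_def comb.subspace_span)

lemma carrier_free_tensors [simp]:
  "u \<in> carrier (free_tensors n A) \<longleftrightarrow> Poly_Mapping.keys u \<subseteq> tuples n A"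
  by (simp add: free_tensors_def)

lemma subspace_free_tensors:
  fixes A :: "('k::field, 'h) graded_algebra"
  shows "comb.subspace (carrier (free_tensors n A))"
proof (rule comb.subspaceI)
  fix u v :: "('k, 'h) tuple_comb" and r
  assume u: "u \<in> carrier (free_tensors n A)"
  then show "scale_comb r u \<in> carrier (free_tensors n A)"
    using keys_scale_comb[of r u] by auto
  assume "v \<in> carrier (free_tensors n A)"
  with u show "u + v \<in> carrier (free_tensors n A)"
    using keys_add[of u v] by auto
qed simp

lemma tensor_class_eq_image: "tensor_class n A u = (\<lambda>r. r + u) ` multilinear_relations n A"
  by (auto simp: tensor_class_def a_r_coset_def' free_tensors_def)

lemma self_in_tensor_class: "u \<in> tensor_class n A u"
  using comb.subspace_0[OF subspace_multilinear_relations]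
  by (force simp: tensor_class_eq_image)

lemma tensor_class_eq_iff: "tensor_class n A u = tensor_class n A v \<longleftrightarrow> u - v \<in> multilinear_relations n A"
proof
  assume "tensor_class n A u = tensor_class n A v"
  then show "u - v \<in> multilinear_relations n A"
    using self_in_tensor_class[of u n A] by (auto simp: tensor_class_eq_image)
next
  note sub = subspace_multilinear_relations[of n A]
  assume uv: "u - v \<in> multilinear_relations n A"
  have "r + u \<in> (\<lambda>r. r + v) ` multilinear_relations n A"
    if "r \<in> multilinear_relations n A" for r
    using comb.subspace_add[OF sub that uv] by (force simp: algebra_simps)
  moreover have "r + v \<in> (\<lambda>r. r + u) ` multilinear_relations n A"
    if "r \<in> multilinear_relations n A" for r
    using comb.subspace_diff[OF sub that uv] by (force simp: algebra_simps)
  ultimately show "tensor_class n A u = tensor_class n A v"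
    by (auto simp: tensor_class_eq_image)
qed

lemma tensor_class_eqI: "v \<in> tensor_class n A u \<Longrightarrow> tensor_class n A v = tensor_class n A u"
  unfolding tensor_class_eq_iff by (auto simp: tensor_class_eq_image)

lemma carrier_tensor_power:
  "carrier (tensor_power n A) = tensor_class n A ` carrier (free_tensors n A)"
  unfolding tensor_power_def FactRing_simps tensor_class_def by auto

lemma add_tensor_class:
  "tensor_class n A u \<oplus>\<^bsub>tensor_power n A\<^esub> tensor_class n A v = tensor_class n A (u + v)"
proof -
  have "tensor_class n A u \<oplus>\<^bsub>tensor_power n A\<^esub> tensor_class n A v
      = (\<Union>x\<in>tensor_class n A u. \<Union>y\<in>tensor_class n A v. {x + y})"
    by (simp add: tensor_power_def FactRing_def set_add_def' free_tensors_def)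
  also have "\<dots> = tensor_class n A (u + v)"
  proof (intro equalityI subsetI)
    fix z assume "z \<in> (\<Union>x\<in>tensor_class n A u. \<Union>y\<in>tensor_class n A v. {x + y})"
    then obtain r s where "r \<in> multilinear_relations n A" "s \<in> multilinear_relations n A"
      "z = (r + s) + (u + v)"
      by (auto simp: tensor_class_eq_image algebra_simps)
    then show "z \<in> tensor_class n A (u + v)"
      unfolding tensor_class_eq_image
      using comb.subspace_add[OF subspace_multilinear_relations[of n A]] by blast
  next
    fix z assume "z \<in> tensor_class n A (u + v)"
    then obtain r where "r \<in> multilinear_relations n A" "z = (r + u) + v"
      by (auto simp: tensor_class_eq_image algebra_simps)
    then show "z \<in> (\<Union>x\<in>tensor_class n A u. \<Union>y\<in>tensor_class n A v. {x + y})"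
      using self_in_tensor_class[of v n A] unfolding tensor_class_eq_image by blast
  qed
  finally show ?thesis .
qed

lemma zero_tensor_power: "\<zero>\<^bsub>tensor_power n A\<^esub> = tensor_class n A 0"
  by (simp add: tensor_power_def FactRing_def tensor_class_eq_image)

lemma one_tensor_power:
  "\<one>\<^bsub>tensor_power n A\<^esub> = tensor_class n A (tuple_vec (\<lambda>i\<in>{1..n}. \<one>\<^bsub>A\<^esub>))"
  by (simp add: tensor_power_def FactRing_def tensor_class_def free_tensors_def)

lemma tensor_class_zero_iff:
  "tensor_class n A u = \<zero>\<^bsub>tensor_power n A\<^esub> \<longleftrightarrow> u \<in> multilinear_relations n A"
  by (simp add: zero_tensor_power tensor_class_eq_iff)

text \<open>The additive structure is a quotient of vector spaces and comes from subspace properties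
  alone. Differences can therefore be computed in every tensor power, in particular in the two-fold
  one on the right-hand side of the congruence.\<close>

lemma abelian_group_tensor_power: "abelian_group (tensor_power n A)"
proof (rule abelian_groupI)
  note sub = subspace_free_tensors[of n A]
  fix P assume "P \<in> carrier (tensor_power n A)"
  then obtain u where u: "u \<in> carrier (free_tensors n A)" "P = tensor_class n A u"
    by (auto simp: carrier_tensor_power)
  then show "\<zero>\<^bsub>tensor_power n A\<^esub> \<oplus>\<^bsub>tensor_power n A\<^esub> P = P"
    by (simp add: zero_tensor_power add_tensor_class)
  show "\<exists>Q\<in>carrier (tensor_power n A). Q \<oplus>\<^bsub>tensor_power n A\<^esub> P = \<zero>\<^bsub>tensor_power n A\<^esub>"
    using u comb.subspace_neg[OF sub u(1)]
    by (intro bexI[of _ "tensor_class n A (- u)"])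
      (auto simp: zero_tensor_power add_tensor_class carrier_tensor_power)
next
  fix P Q assume "P \<in> carrier (tensor_power n A)" "Q \<in> carrier (tensor_power n A)"
  then show "P \<oplus>\<^bsub>tensor_power n A\<^esub> Q \<in> carrier (tensor_power n A)"
    unfolding carrier_tensor_power using comb.subspace_add[OF subspace_free_tensors[of n A]]
    by (auto simp add: add_tensor_class simp del: carrier_free_tensors)
next
  show "\<zero>\<^bsub>tensor_power n A\<^esub> \<in> carrier (tensor_power n A)"
    by (simp add: carrier_tensor_power zero_tensor_power)
qed (auto simp: carrier_tensor_power add_tensor_class ac_simps simp del: carrier_free_tensors)

lemma minus_tensor_class:
  assumes "u \<in> carrier (free_tensors n A)" "v \<in> carrier (free_tensors n A)"
  shows "tensor_class n A u \<ominus>\<^bsub>tensor_power n A\<^esub> tensor_class n A v = tensor_class n A (u - v)"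
proof -
  interpret abelian_group "tensor_power n A"
    by (rule abelian_group_tensor_power)
  have "- v \<in> carrier (free_tensors n A)"
    using comb.subspace_neg[OF subspace_free_tensors assms(2)] .
  then have "\<ominus>\<^bsub>tensor_power n A\<^esub> tensor_class n A v = tensor_class n A (- v)"
    by (intro minus_equality)
      (use assms in \<open>auto simp: carrier_tensor_power add_tensor_class zero_tensor_power\<close>)
  then show ?thesis
    by (simp add: a_minus_def add_tensor_class)
qed

text \<open>The product in the factor structure is a union of cosets over all pairs of
  representatives. Closure of the ring makes this union a single coset, and it contains the product
  of the given representatives, which determines it.\<close>

lemma mult_tensor_class:
  assumes "ring (tensor_power n A)"
    and "u \<in> carrier (free_tensors n A)" "v \<in> carrier (free_tensors n A)"
  shows "tensor_class n A u \<otimes>\<^bsub>tensor_power n A\<^esub> tensor_class n A v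
    = tensor_class n A (bilinear_extension (koszul_tuple n A) u v)"
proof -
  interpret ring "tensor_power n A"
    by fact
  let ?P = "tensor_class n A u \<otimes>\<^bsub>tensor_power n A\<^esub> tensor_class n A v"
  have P: "?P = (\<Union>x\<in>tensor_class n A u. \<Union>y\<in>tensor_class n A v.
      tensor_class n A (bilinear_extension (koszul_tuple n A) x y))"
    by (simp add: tensor_power_def FactRing_def rcoset_mult_def tensor_class_def free_tensors_def)
  have "?P \<in> carrier (tensor_power n A)"
    by (rule m_closed) (use assms in \<open>auto simp: carrier_tensor_power\<close>)
  then obtain w where w: "?P = tensor_class n A w"
    by (auto simp: carrier_tensor_power)
  have "bilinear_extension (koszul_tuple n A) u v \<in> ?P"
    unfolding P using self_in_tensor_class by blast
  then show ?thesis
    unfolding w by (rule tensor_class_eqI[symmetric])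
qed

text \<open>
  \<open>map_single\<close> rewrites \<open>scale_comb r (tuple_vec x)\<close> to \<open>Poly_Mapping.single x r\<close>, which hides the
  linear structure.
\<close>

declare map_single [simp del]

text \<open>Reduces a statement about a general left argument to basis tuples while the right
  argument stays a combination.\<close>

lemma bilinear_extension_expand_left:
  "bilinear_extension m u v =
    (\<Sum>x\<in>Poly_Mapping.keys u. scale_comb (Poly_Mapping.lookup u x) (bilinear_extension m (tuple_vec x) v))"
  by (simp add: bilinear_extension_def comb.scale_sum_right)

lemma bilinear_extension_expand_right:
  "bilinear_extension m u v =
    (\<Sum>y\<in>Poly_Mapping.keys v. scale_comb (Poly_Mapping.lookup v y) (bilinear_extension m u (tuple_vec y)))"
  unfolding bilinear_extension_def
  by (subst sum.swap) (simp add: comb.scale_sum_right mult.commute)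

text \<open>The closure laws keep the multilinearity relations inside the free tensors. The law for
  the scalar 0 turns every tuple with a zero entry into a relation.\<close>

locale graded_space =
  fixes A :: "('k::field, 'h) graded_algebra"
  assumes add_closed: "b \<in> carrier A \<Longrightarrow> c \<in> carrier A \<Longrightarrow> b \<oplus>\<^bsub>A\<^esub> c \<in> carrier A"
    and smult_closed: "b \<in> carrier A \<Longrightarrow> r \<odot>\<^bsub>A\<^esub> b \<in> carrier A"
    and smult_zero: "b \<in> carrier A \<Longrightarrow> 0 \<odot>\<^bsub>A\<^esub> b = \<zero>\<^bsub>A\<^esub>"
begin

lemma tuples_upd: "x \<in> tuples n A \<Longrightarrow> i \<in> {1..n} \<Longrightarrow> b \<in> carrier A \<Longrightarrow> x(i := b) \<in> tuples n A"
  by (auto simp: tuples_def PiE_iff extensional_def)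

lemma tuple_vec_carrier: "x \<in> tuples n A \<Longrightarrow> tuple_vec x \<in> carrier (free_tensors n A)"
  by simp

lemma multilinear_relations_subset: "multilinear_relations n A \<subseteq> carrier (free_tensors n A)"
proof -
  note sub = subspace_free_tensors[of n A]
  show ?thesis
    unfolding multilinear_relations_def
    by (rule comb.span_minimal[OF _ sub])
      (auto simp del: carrier_free_tensors
        intro!: comb.subspace_diff[OF sub] comb.subspace_scale[OF sub] tuple_vec_carrier
          tuples_upd add_closed smult_closed)
qed

text \<open>Two representatives of a coset differ by a relation, and relations lie among the free
  tensors; so if one representative does, all do. Through this equivalence, closure of the tensor
  power yields information about the entries of tuples.\<close>

lemma tensor_class_in_carrier_iff:
  "tensor_class n A u \<in> carrier (tensor_power n A) \<longleftrightarrow> u \<in> carrier (free_tensors n A)"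
proof
  assume "tensor_class n A u \<in> carrier (tensor_power n A)"
  then obtain v where v: "v \<in> carrier (free_tensors n A)" "tensor_class n A u = tensor_class n A v"
    by (auto simp: carrier_tensor_power)
  then have "u - v \<in> carrier (free_tensors n A)"
    using multilinear_relations_subset[of n] by (simp only: tensor_class_eq_iff) blast
  then have "u - v + v \<in> carrier (free_tensors n A)"
    using v(1) by (rule comb.subspace_add[OF subspace_free_tensors])
  then show "u \<in> carrier (free_tensors n A)"
    by simp
qed (simp add: carrier_tensor_power)

lemma add_relation:
  assumes "x \<in> tuples n A" "i \<in> {1..n}" "b \<in> carrier A" "c \<in> carrier A"
  shows "tuple_vec (x(i := b \<oplus>\<^bsub>A\<^esub> c)) - tuple_vec (x(i := b)) - tuple_vec (x(i := c))
    \<in> multilinear_relations n A"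
  unfolding multilinear_relations_def by (rule comb.span_base) (use assms in blast)

lemma smult_relation:
  assumes "x \<in> tuples n A" "i \<in> {1..n}" "b \<in> carrier A"
  shows "tuple_vec (x(i := r \<odot>\<^bsub>A\<^esub> b)) - scale_comb r (tuple_vec (x(i := b)))
    \<in> multilinear_relations n A"
  unfolding multilinear_relations_def by (rule comb.span_base) (use assms in blast)

text \<open>Writing the zero entry as 0 times itself, the scalar relation identifies the tuple with
  0 times a tuple.\<close>

lemma tensor_class_zero_entry:
  assumes "x \<in> tuples n A" "i \<in> {1..n}" "x i = \<zero>\<^bsub>A\<^esub>"
  shows "tensor_class n A (tuple_vec x) = \<zero>\<^bsub>tensor_power n A\<^esub>"
proof -
  have "x i \<in> carrier A"
    using assms(1,2) unfolding tuples_def by (rule PiE_mem)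
  with assms have "x(i := 0 \<odot>\<^bsub>A\<^esub> x i) = x"
    by (simp only: smult_zero fun_upd_idem)
  with smult_relation[OF assms(1,2) \<open>x i \<in> carrier A\<close>, of 0] show ?thesis
    by (simp add: tensor_class_zero_iff)
qed

section \<open>Juxtaposition of tensors\<close>

definition juxtapose_tuples :: "nat \<Rightarrow> nat \<Rightarrow> (nat \<Rightarrow> 'h) \<Rightarrow> (nat \<Rightarrow> 'h) \<Rightarrow> nat \<Rightarrow> 'h" where
  "juxtapose_tuples m n x y = (\<lambda>i\<in>{1..m + n}. if i \<le> m then x i else y (i - m))"

lemma juxtapose_tuples_closed:
  assumes "x \<in> tuples m A" "y \<in> tuples n A"
  shows "juxtapose_tuples m n x y \<in> tuples (m + n) A"
proof -
  have "i - m \<in> {1..n}" if "i \<in> {1..m + n}" "\<not> i \<le> m" for i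
    using that by auto
  then show ?thesis
    using assms by (auto simp: tuples_def juxtapose_tuples_def PiE_iff)
qed

text \<open>Changing one entry of a factor changes one entry of the juxtaposed tuple. This is why
  generators of the relations are sent to generators.\<close>

lemma juxtapose_tuples_upd_left:
  "i \<in> {1..m} \<Longrightarrow> juxtapose_tuples m n (x(i := b)) y = (juxtapose_tuples m n x y)(i := b)"
  by (auto simp: juxtapose_tuples_def fun_eq_iff)

lemma juxtapose_tuples_upd_right:
  "i \<in> {1..n} \<Longrightarrow> juxtapose_tuples m n x (y(i := b)) = (juxtapose_tuples m n x y)(m + i := b)"
  by (auto simp: juxtapose_tuples_def fun_eq_iff)

abbreviation juxtapose_combs ::
  "nat \<Rightarrow> nat \<Rightarrow> ('k, 'h) tuple_comb \<Rightarrow> ('k, 'h) tuple_comb \<Rightarrow> ('k, 'h) tuple_comb" where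
  "juxtapose_combs m n \<equiv> bilinear_extension (\<lambda>x y. tuple_vec (juxtapose_tuples m n x y))"

text \<open>For a fixed basis tuple on the right, each generator goes to a generator at the same
  position. A general right factor is a combination of such tuples.\<close>

lemma juxtapose_relations_left:
  assumes "u \<in> multilinear_relations m A" "v \<in> carrier (free_tensors n A)"
  shows "juxtapose_combs m n u v \<in> multilinear_relations (m + n) A"
proof -
  note sub = subspace_multilinear_relations[of "m + n" A]
  have "juxtapose_combs m n u (tuple_vec y) \<in> multilinear_relations (m + n) A"
    if y: "y \<in> tuples n A" for y
  proof -
    interpret Vector_Spaces.linear scale_comb scale_comb "\<lambda>u. juxtapose_combs m n u (tuple_vec y)"
      by (rule linear_bilinear_extension_left)
    from assms(1) show ?thesis
      unfolding multilinear_relations_def[of m]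
      by (rule bilinear_extension_span_left[OF _ sub])
        (use y in \<open>auto simp: diff scale juxtapose_tuples_upd_left
            intro!: add_relation smult_relation juxtapose_tuples_closed\<close>)
  qed
  then show ?thesis
    using assms(2) by (subst bilinear_extension_expand_right)
      (auto intro!: comb.subspace_sum[OF sub] comb.subspace_scale[OF sub])
qed

lemma juxtapose_relations_right:
  assumes "u \<in> carrier (free_tensors m A)" "v \<in> multilinear_relations n A"
  shows "juxtapose_combs m n u v \<in> multilinear_relations (m + n) A"
proof -
  note sub = subspace_multilinear_relations[of "m + n" A]
  have "juxtapose_combs m n (tuple_vec x) v \<in> multilinear_relations (m + n) A"
    if x: "x \<in> tuples m A" for x
  proof -
    interpret Vector_Spaces.linear scale_comb scale_comb "juxtapose_combs m n (tuple_vec x)"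
      by (rule linear_bilinear_extension_right)
    from assms(2) show ?thesis
      unfolding multilinear_relations_def[of n]
      by (rule bilinear_extension_span_right[OF _ sub])
        (use x in \<open>auto simp: diff scale juxtapose_tuples_upd_right
            intro!: add_relation smult_relation juxtapose_tuples_closed\<close>)
  qed
  then show ?thesis
    using assms(1) by (subst bilinear_extension_expand_left)
      (auto intro!: comb.subspace_sum[OF sub] comb.subspace_scale[OF sub])
qed

text \<open>Independence of representatives: writing juxtaposition as a product,
  \<open>u' v' - u v = (u' - u) v' + u (v' - v)\<close>, and both summands are relations. Hence the
  union in \<open>juxtapose\<close> consists of a single coset.\<close>

lemma juxtapose_tensor_class:
  assumes u: "u \<in> carrier (free_tensors m A)" and v: "v \<in> carrier (free_tensors n A)"
  shows "juxtapose m n A (tensor_class m A u) (tensor_class n A v)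
    = tensor_class (m + n) A (juxtapose_combs m n u v)"
proof -
  have "tensor_class (m + n) A (juxtapose_combs m n u' v')
      = tensor_class (m + n) A (juxtapose_combs m n u v)"
    if "u' \<in> tensor_class m A u" "v' \<in> tensor_class n A v" for u' v'
  proof -
    interpret l: Vector_Spaces.linear scale_comb scale_comb "\<lambda>u. juxtapose_combs m n u v'"
      by (rule linear_bilinear_extension_left)
    interpret r: Vector_Spaces.linear scale_comb scale_comb "juxtapose_combs m n u"
      by (rule linear_bilinear_extension_right)
    have u': "u' - u \<in> multilinear_relations m A" and v': "v' - v \<in> multilinear_relations n A"
      using that by (auto simp: tensor_class_eq_image)
    have "tensor_class n A v' = tensor_class n A v"
      using that(2) by (rule tensor_class_eqI)
    then have "v' \<in> carrier (free_tensors n A)"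
      using v by (metis tensor_class_in_carrier_iff)
    then have "juxtapose_combs m n (u' - u) v' + juxtapose_combs m n u (v' - v)
        \<in> multilinear_relations (m + n) A"
      by (intro comb.subspace_add[OF subspace_multilinear_relations]
          juxtapose_relations_left juxtapose_relations_right u u' v')
    then show ?thesis
      by (simp add: tensor_class_eq_iff l.diff r.diff)
  qed
  then show ?thesis
    using self_in_tensor_class[of u m A] self_in_tensor_class[of v n A]
    unfolding juxtapose_def juxtapose_tuples_def by blast
qed

end

section \<open>Products of homogeneous pure tensors\<close>

definition homogeneous :: "('k, 'h) graded_algebra \<Rightarrow> nat \<Rightarrow> 'h \<Rightarrow> bool" where
  "homogeneous A d x \<longleftrightarrow>
    x \<in> carrier A \<and> (\<forall>p. component A p x = (if p = d then x else \<zero>\<^bsub>A\<^esub>))"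

text \<open>A nonzero homogeneous entry has exactly one nonzero component, so a single multidegree
  contributes and the double sum in \<open>koszul_tuple\<close> collapses to one term. Vanishing
  entries are excluded because homogeneous zero has no nonzero component, which would leave no
  multidegree at all.\<close>

lemma multidegrees_homogeneous:
  assumes "\<And>i. i \<in> {1..n} \<Longrightarrow> homogeneous A (p i) (x i) \<and> x i \<noteq> \<zero>\<^bsub>A\<^esub>"
  shows "multidegrees n A x = {restrict p {1..n}}"
proof -
  have "q = restrict p {1..n}" if "q \<in> multidegrees n A x" for q
  proof
    fix i
    show "q i = restrict p {1..n} i"
      using that assms[of i]
      by (cases "i \<in> {1..n}")
        (auto simp: multidegrees_def homogeneous_def extensional_def PiE_iff split: if_splits)
  qed
  moreover have "restrict p {1..n} \<in> multidegrees n A x"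
    using assms by (auto simp: multidegrees_def homogeneous_def)
  ultimately show ?thesis
    by blast
qed

lemma koszul_tuple_homogeneous:
  assumes x: "\<And>i. i \<in> {1..n} \<Longrightarrow> homogeneous A (p i) (x i) \<and> x i \<noteq> \<zero>\<^bsub>A\<^esub>"
    and y: "\<And>i. i \<in> {1..n} \<Longrightarrow> homogeneous A (q i) (y i) \<and> y i \<noteq> \<zero>\<^bsub>A\<^esub>"
  shows "koszul_tuple n A x y = scale_comb ((-1) ^ (\<Sum>i\<in>{1..n}. \<Sum>j\<in>{1..<i}. p i * q j))
    (tuple_vec (\<lambda>i\<in>{1..n}. x i \<otimes>\<^bsub>A\<^esub> y i))"
proof -
  have "(\<Sum>i\<in>{1..n}. \<Sum>j\<in>{1..<i}. restrict p {1..n} i * restrict q {1..n} j)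
      = (\<Sum>i\<in>{1..n}. \<Sum>j\<in>{1..<i}. p i * q j)"
    by (intro sum.cong) auto
  moreover have "(\<lambda>i\<in>{1..n}. component A (restrict p {1..n} i) (x i) \<otimes>\<^bsub>A\<^esub>
      component A (restrict q {1..n} i) (y i)) = (\<lambda>i\<in>{1..n}. x i \<otimes>\<^bsub>A\<^esub> y i)"
    using x y by (auto simp: homogeneous_def fun_eq_iff)
  ultimately show ?thesis
    unfolding koszul_tuple_def
    by (simp only: multidegrees_homogeneous[OF x] multidegrees_homogeneous[OF y]) simp
qed

context graded_space
begin

lemma pure_tensor_carrier:
  assumes "\<And>i. i \<in> {1..n} \<Longrightarrow> x i \<in> carrier A"
  shows "tuple_vec (restrict x {1..n}) \<in> carrier (free_tensors n A)"
    and "pure_tensor n A x \<in> carrier (tensor_power n A)"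
  using assms by (auto simp: tuples_def pure_tensor_def tensor_class_in_carrier_iff)

lemma pure_tensor_zero_entry:
  assumes "\<And>i. i \<in> {1..n} \<Longrightarrow> x i \<in> carrier A" "i \<in> {1..n}" "x i = \<zero>\<^bsub>A\<^esub>"
  shows "pure_tensor n A x = \<zero>\<^bsub>tensor_power n A\<^esub>"
  unfolding pure_tensor_def
  by (rule tensor_class_zero_entry[of _ _ i]) (use assms in \<open>auto simp: tuples_def\<close>)

text \<open>Only one pair of multidegrees contributes, which gives the Koszul rule. The second claim
  is extracted from closure of the tensor power: the product is a signed single tuple that has to
  lie among the free tensors.\<close>

lemma homogeneous_pure_tensor_mult:
  assumes ring: "ring (tensor_power n A)"
    and x: "\<And>i. i \<in> {1..n} \<Longrightarrow> homogeneous A (p i) (x i) \<and> x i \<noteq> \<zero>\<^bsub>A\<^esub>"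
    and y: "\<And>i. i \<in> {1..n} \<Longrightarrow> homogeneous A (q i) (y i) \<and> y i \<noteq> \<zero>\<^bsub>A\<^esub>"
  shows "pure_tensor n A x \<otimes>\<^bsub>tensor_power n A\<^esub> pure_tensor n A y
      = tensor_class n A (scale_comb ((-1) ^ (\<Sum>i\<in>{1..n}. \<Sum>j\<in>{1..<i}. p i * q j))
          (tuple_vec (\<lambda>i\<in>{1..n}. x i \<otimes>\<^bsub>A\<^esub> y i)))" (is "_ = tensor_class n A ?u")
    and "\<And>i. i \<in> {1..n} \<Longrightarrow> x i \<otimes>\<^bsub>A\<^esub> y i \<in> carrier A"
proof -
  interpret ring "tensor_power n A"
    by fact
  have x': "x i \<in> carrier A" and y': "y i \<in> carrier A" if "i \<in> {1..n}" for i
    using x[OF that] y[OF that] by (auto simp: homogeneous_def)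
  note carrier = pure_tensor_carrier(1)[of n x, OF x'] pure_tensor_carrier(1)[of n y, OF y']
  have "koszul_tuple n A (restrict x {1..n}) (restrict y {1..n}) = ?u"
    using x y by (subst koszul_tuple_homogeneous[where p = p and q = q]) (auto cong: restrict_cong)
  then show eq: "pure_tensor n A x \<otimes>\<^bsub>tensor_power n A\<^esub> pure_tensor n A y = tensor_class n A ?u"
    by (simp only: pure_tensor_def mult_tensor_class[OF ring carrier] bilinear_extension_tuple_vec)
  have "tensor_class n A ?u \<in> carrier (tensor_power n A)"
    unfolding eq[symmetric] by (intro m_closed pure_tensor_carrier x' y')
  \<comment> \<open>The coefficient is a sign, hence nonzero, so the tuple really is a key of the
    representative.\<close>
  then have "(\<lambda>i\<in>{1..n}. x i \<otimes>\<^bsub>A\<^esub> y i) \<in> tuples n A"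
    by (simp add: tensor_class_in_carrier_iff map_single)
  then show "x i \<otimes>\<^bsub>A\<^esub> y i \<in> carrier A" if "i \<in> {1..n}" for i
    using that by (auto simp: tuples_def PiE_iff)
qed

text \<open>Translates a Koszul sign, which is a scalar of the field, into the negation of the ring
  in which the ideal argument takes place.\<close>

lemma tensor_class_scale_sign:
  assumes "u \<in> carrier (free_tensors n A)"
  shows "tensor_class n A (scale_comb ((-1) ^ k) u) = tensor_class n A u \<or>
    tensor_class n A (scale_comb ((-1) ^ k) u) = \<ominus>\<^bsub>tensor_power n A\<^esub> tensor_class n A u"
proof (cases "even k")
  case True
  then show ?thesis
    by simp
next
  case False
  interpret abelian_group "tensor_power n A"
    by (rule abelian_group_tensor_power)
  have "- u \<in> carrier (free_tensors n A)"
    using comb.subspace_neg[OF subspace_free_tensors assms] .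
  then have "\<ominus>\<^bsub>tensor_power n A\<^esub> tensor_class n A u = tensor_class n A (- u)"
    by (intro minus_equality)
      (use assms in \<open>auto simp: tensor_class_in_carrier_iff add_tensor_class zero_tensor_power\<close>)
  with False show ?thesis
    by simp
qed

end

text \<open>
  The two unit laws are assumed only for products that lie in the carrier: that products in the
  cohomology algebra do lie there is read off from the closure of the tensor power.
\<close>

locale homogeneous_element = graded_space A
  for A :: "('k::field, 'h) graded_algebra" +
  fixes a :: 'h and d n :: nat
  assumes ring: "ring (tensor_power n A)"
    and homogeneous_elem: "homogeneous A d a" and elem_nonzero: "a \<noteq> \<zero>\<^bsub>A\<^esub>"
    and homogeneous_one: "homogeneous A 0 \<one>\<^bsub>A\<^esub>" and one_nonzero: "\<one>\<^bsub>A\<^esub> \<noteq> \<zero>\<^bsub>A\<^esub>"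
    and one_mult: "b \<in> carrier A \<Longrightarrow> \<one>\<^bsub>A\<^esub> \<otimes>\<^bsub>A\<^esub> b \<in> carrier A \<Longrightarrow> \<one>\<^bsub>A\<^esub> \<otimes>\<^bsub>A\<^esub> b = b"
    and mult_one: "b \<in> carrier A \<Longrightarrow> b \<otimes>\<^bsub>A\<^esub> \<one>\<^bsub>A\<^esub> \<in> carrier A \<Longrightarrow> b \<otimes>\<^bsub>A\<^esub> \<one>\<^bsub>A\<^esub> = b"
begin

section \<open>Tensors all of whose entries are \<open>a\<close> or \<open>1\<close>\<close>

abbreviation T :: "('k, 'h) tuple_comb set ring" where
  "T \<equiv> tensor_power n A"

sublocale T: ring T
  by (rule ring)

text \<open>All tensors in the congruence have entries \<open>a\<close> and \<open>1\<close> only,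
  so they are recorded by the set of positions of \<open>a\<close>. Products of tensors with
  disjoint sets then become unions, up to sign. Elements of \<open>S\<close> outside
  \<open>{1..n}\<close> have no effect.\<close>

definition indicator_tensor :: "nat set \<Rightarrow> ('k, 'h) tuple_comb set" where
  "indicator_tensor S = pure_tensor n A (\<lambda>i. if i \<in> S then a else \<one>\<^bsub>A\<^esub>)"

lemma entry_homogeneous:
  "homogeneous A (if i \<in> S then d else 0) (if i \<in> S then a else \<one>\<^bsub>A\<^esub>) \<and>
    (if i \<in> S then a else \<one>\<^bsub>A\<^esub>) \<noteq> \<zero>\<^bsub>A\<^esub>"
  by (simp add: homogeneous_elem homogeneous_one elem_nonzero one_nonzero)

lemma entry_carrier: "(if i \<in> S then a else \<one>\<^bsub>A\<^esub>) \<in> carrier A"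
  using entry_homogeneous[of i S] by (simp add: homogeneous_def)

lemma indicator_tensor_carrier: "indicator_tensor S \<in> carrier T"
  unfolding indicator_tensor_def by (rule pure_tensor_carrier(2)) (rule entry_carrier)

lemma in_position_eq: "in_position n A a i = indicator_tensor {i}"
  by (simp add: in_position_def indicator_tensor_def)

lemma one_eq: "\<one>\<^bsub>T\<^esub> = indicator_tensor {}"
  by (simp add: one_tensor_power indicator_tensor_def pure_tensor_def)

lemmas entries_mult = homogeneous_pure_tensor_mult[OF ring,
    where x = "\<lambda>i. if i \<in> S then a else \<one>\<^bsub>A\<^esub>" and p = "\<lambda>i. if i \<in> S then d else 0"
      and y = "\<lambda>i. if i \<in> S' then a else \<one>\<^bsub>A\<^esub>" and q = "\<lambda>i. if i \<in> S' then d else 0" for S S',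
    OF entry_homogeneous entry_homogeneous]

text \<open>The Koszul exponent runs over pairs with a position of the left factor greater than one
  of the right factor. Under the ordering assumption no such pair carries \<open>a\<close> in both
  places, so the exponent is 0.\<close>

lemma indicator_tensor_mult_ordered:
  assumes "\<And>i j. i \<in> S \<Longrightarrow> j \<in> S' \<Longrightarrow> i \<le> j"
  shows "indicator_tensor S \<otimes>\<^bsub>T\<^esub> indicator_tensor S' = pure_tensor n A
    (\<lambda>i. (if i \<in> S then a else \<one>\<^bsub>A\<^esub>) \<otimes>\<^bsub>A\<^esub> (if i \<in> S' then a else \<one>\<^bsub>A\<^esub>))"
proof -
  have "(\<Sum>i\<in>{1..n}. \<Sum>j\<in>{1..<i}. (if i \<in> S then d else 0) * (if j \<in> S' then d else 0)) = 0"
    by (intro sum.neutral ballI) (auto dest: assms)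
  then show ?thesis
    unfolding indicator_tensor_def entries_mult(1)
    by (simp only: pure_tensor_def power_0 comb.scale_one)
qed

text \<open>One of the two entries is the unit. The unit laws ask for the product to lie in the
  carrier, which \<open>entries_mult(2)\<close> supplies.\<close>

lemma entry_mult_disjoint:
  assumes "S \<inter> S' = {}" "i \<in> {1..n}"
  shows "(if i \<in> S then a else \<one>\<^bsub>A\<^esub>) \<otimes>\<^bsub>A\<^esub> (if i \<in> S' then a else \<one>\<^bsub>A\<^esub>)
    = (if i \<in> S \<union> S' then a else \<one>\<^bsub>A\<^esub>)"
  using entries_mult(2)[OF assms(2), of S S']
    one_mult[OF entry_carrier[of i S']] mult_one[OF entry_carrier[of i S]] assms(1)
  by (auto split: if_splits)

lemma indicator_tensor_mult_disjoint:
  assumes "\<And>i j. i \<in> S \<Longrightarrow> j \<in> S' \<Longrightarrow> i < j"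
  shows "indicator_tensor S \<otimes>\<^bsub>T\<^esub> indicator_tensor S' = indicator_tensor (S \<union> S')"
proof -
  have "S \<inter> S' = {}"
    using assms by blast
  then show ?thesis
    using assms by (subst indicator_tensor_mult_ordered)
      (auto simp: indicator_tensor_def pure_tensor_def entry_mult_disjoint intro: less_imp_le
        cong: restrict_cong)
qed

text \<open>Identifies the square of \<open>a_1\<close> with the first generator of the
  ideal.\<close>

lemma indicator_tensor_square:
  "indicator_tensor {1} \<otimes>\<^bsub>T\<^esub> indicator_tensor {1}
    = pure_tensor n A (\<lambda>i. if i = 1 then a \<otimes>\<^bsub>A\<^esub> a else \<one>\<^bsub>A\<^esub>)"
proof -
  have "\<one>\<^bsub>A\<^esub> \<otimes>\<^bsub>A\<^esub> \<one>\<^bsub>A\<^esub> = \<one>\<^bsub>A\<^esub>" if "i \<in> {1..n}" for i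
    using entry_mult_disjoint[of "{}" "{}" i] that by simp
  then show ?thesis
    by (subst indicator_tensor_mult_ordered)
      (auto simp: pure_tensor_def cong: restrict_cong intro!: arg_cong[where f = "\<lambda>x. tensor_class n A (tuple_vec x)"])
qed

text \<open>The Koszul sign depends on the degree of \<open>a\<close>, but either sign serves: the
  result is used only for membership in an ideal and for moving \<open>a_1\<close> to the left of a
  product.\<close>

lemma indicator_tensor_commute:
  assumes "j > 1"
  shows "indicator_tensor {j} \<otimes>\<^bsub>T\<^esub> indicator_tensor {1} = indicator_tensor {1, j} \<or>
    indicator_tensor {j} \<otimes>\<^bsub>T\<^esub> indicator_tensor {1} = \<ominus>\<^bsub>T\<^esub> indicator_tensor {1, j}"
proof -
  have "{j} \<inter> {1} = {}"
    using assms by auto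
  note entries = entry_mult_disjoint[OF this]
  have "{j} \<union> {1} = {1, j}"
    by auto
  then have tuple: "(\<lambda>i\<in>{1..n}. (if i \<in> {j} then a else \<one>\<^bsub>A\<^esub>) \<otimes>\<^bsub>A\<^esub> (if i \<in> {1} then a else \<one>\<^bsub>A\<^esub>))
      = (\<lambda>i\<in>{1..n}. if i \<in> {1, j} then a else \<one>\<^bsub>A\<^esub>)"
    using entries by (intro restrict_ext) metis
  have "tuple_vec (\<lambda>i\<in>{1..n}. if i \<in> {1, j} then a else \<one>\<^bsub>A\<^esub>) \<in> carrier (free_tensors n A)"
    by (rule pure_tensor_carrier(1)) (rule entry_carrier)
  from tensor_class_scale_sign[OF this] show ?thesis
    unfolding indicator_tensor_def entries_mult(1) tuple
    by (simp only: pure_tensor_def)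
qed

text \<open>Going down from the empty product, each new factor stands to the left of all positions
  already filled, so no sign arises.\<close>

lemma indicator_tensor_foldr:
  assumes "2 \<le> k"
  shows "foldr (\<lambda>j t. indicator_tensor {j} \<otimes>\<^bsub>T\<^esub> t) [k..<Suc n] \<one>\<^bsub>T\<^esub> = indicator_tensor {k..n}"
proof (cases "k \<le> Suc n")
  case True
  then show ?thesis
  proof (induction rule: inc_induct)
    case base
    then show ?case
      by (simp add: one_eq)
  next
    case (step m)
    then have "{m} \<union> {Suc m..n} = {m..n}"
      by auto
    with step indicator_tensor_mult_disjoint[of "{m}" "{Suc m..n}"] show ?case
      by (simp add: upt_conv_Cons del: upt_Suc)
  qed
next
  case False
  then show ?thesis
    by (simp add: one_eq)
qed

end

text \<open>Juxtaposition is linear in its left argument, so the difference can be taken after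
  juxtaposing. This expands the right-hand side of the congruence into two pure tensors.\<close>

lemma (in graded_space) juxtapose_minus_pure_tensor:
  assumes x: "\<And>i. i \<in> {1..m} \<Longrightarrow> x i \<in> carrier A" and y: "\<And>i. i \<in> {1..m} \<Longrightarrow> y i \<in> carrier A"
    and z: "\<And>i. i \<in> {1..n} \<Longrightarrow> z i \<in> carrier A"
  shows "juxtapose m n A (pure_tensor m A x \<ominus>\<^bsub>tensor_power m A\<^esub> pure_tensor m A y) (pure_tensor n A z)
    = pure_tensor (m + n) A (\<lambda>i. if i \<le> m then x i else z (i - m))
      \<ominus>\<^bsub>tensor_power (m + n) A\<^esub> pure_tensor (m + n) A (\<lambda>i. if i \<le> m then y i else z (i - m))"
proof -
  interpret l: Vector_Spaces.linear scale_comb scale_comb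
    "\<lambda>u. juxtapose_combs m n u (tuple_vec (restrict z {1..n}))"
    by (rule linear_bilinear_extension_left)
  note x' = pure_tensor_carrier(1)[of m x, OF x] and y' = pure_tensor_carrier(1)[of m y, OF y]
    and z' = pure_tensor_carrier(1)[of n z, OF z]
  have tuple: "juxtapose_tuples m n (restrict w {1..m}) (restrict z {1..n})
      = (\<lambda>i\<in>{1..m + n}. if i \<le> m then w i else z (i - m))" for w
    unfolding juxtapose_tuples_def by (intro restrict_ext) auto
  have carrier: "tuple_vec (\<lambda>i\<in>{1..m + n}. if i \<le> m then w i else z (i - m))
      \<in> carrier (free_tensors (m + n) A)" if w: "\<And>i. i \<in> {1..m} \<Longrightarrow> w i \<in> carrier A" for w
  proof (rule pure_tensor_carrier(1))
    fix i assume "i \<in> {1..m + n}"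
    then show "(if i \<le> m then w i else z (i - m)) \<in> carrier A"
      by (auto intro!: w z[of "i - m"])
  qed
  have "pure_tensor m A x \<ominus>\<^bsub>tensor_power m A\<^esub> pure_tensor m A y
      = tensor_class m A (tuple_vec (restrict x {1..m}) - tuple_vec (restrict y {1..m}))"
    unfolding pure_tensor_def by (rule minus_tensor_class[OF x' y'])
  moreover have "tuple_vec (restrict x {1..m}) - tuple_vec (restrict y {1..m})
      \<in> carrier (free_tensors m A)"
    by (rule comb.subspace_diff[OF subspace_free_tensors x' y'])
  ultimately show ?thesis
    unfolding pure_tensor_def
    by (simp only: juxtapose_tensor_class[OF _ z'] l.diff bilinear_extension_tuple_vec tuple
        minus_tensor_class[OF carrier carrier] x y)
qed

section \<open>The congruence in a tensor power\<close>

lemma (in ring) int_add_pow_uminus: "a \<in> carrier R \<Longrightarrow> [(- k :: int)] \<cdot>\<^bsub>R\<^esub> a = \<ominus> ([k] \<cdot>\<^bsub>R\<^esub> a)"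
  by (rule add.int_pow_neg)

lemma (in ring) int_add_pow_closed: "a \<in> carrier R \<Longrightarrow> [(k :: int)] \<cdot>\<^bsub>R\<^esub> a \<in> carrier R"
  by (rule add.int_pow_closed)

text \<open>In \<open>(x - f j) (c P + x s)\<close> the term \<open>- f j c P\<close> continues the
  main term with the opposite sign. All others begin with \<open>x\<close>, the last one because
  \<open>f j x s = x w s\<close> for the \<open>w\<close> provided by the assumption.\<close>

lemma (in ring) foldr_minus_mult:
  assumes "x \<in> carrier R"
    and "\<And>j. j \<in> set js \<Longrightarrow> f j \<in> carrier R \<and> (\<exists>w\<in>carrier R. f j \<otimes> x = x \<otimes> w)"
  shows "foldr (\<lambda>j t. f j \<otimes> t) js \<one> \<in> carrier R \<and>
    (\<exists>s\<in>carrier R. foldr (\<lambda>j t. (x \<ominus> f j) \<otimes> t) js \<one>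
      = [((-1 :: int) ^ length js)] \<cdot>\<^bsub>R\<^esub> foldr (\<lambda>j t. f j \<otimes> t) js \<one> \<oplus> x \<otimes> s)"
  using assms(2)
proof (induction js)
  case Nil
  have "\<one> = [(1 :: int)] \<cdot>\<^bsub>R\<^esub> \<one> \<oplus> x \<otimes> \<zero>"
    using assms(1) by (simp add: add.int_pow_1)
  then show ?case
    by (auto intro!: bexI[of _ \<zero>])
next
  case (Cons j js)
  define P where "P = foldr (\<lambda>j t. f j \<otimes> t) js \<one>"
  define c where "c = (-1 :: int) ^ length js"
  from Cons obtain s where P: "P \<in> carrier R" and s: "s \<in> carrier R"
    and eq: "foldr (\<lambda>j t. (x \<ominus> f j) \<otimes> t) js \<one> = [c] \<cdot>\<^bsub>R\<^esub> P \<oplus> x \<otimes> s"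
    unfolding P_def c_def by auto
  from Cons.prems obtain w where y: "f j \<in> carrier R" and w: "w \<in> carrier R" "f j \<otimes> x = x \<otimes> w"
    by auto
  note closed = assms(1) P s y w(1) int_add_pow_closed[OF P]
  have "(x \<ominus> f j) \<otimes> ([c] \<cdot>\<^bsub>R\<^esub> P \<oplus> x \<otimes> s)
      = x \<otimes> ([c] \<cdot>\<^bsub>R\<^esub> P \<oplus> x \<otimes> s) \<oplus> (\<ominus> (f j \<otimes> [c] \<cdot>\<^bsub>R\<^esub> P) \<oplus> \<ominus> (f j \<otimes> x \<otimes> s))"
    using closed by (simp add: minus_eq l_distr r_distr l_minus m_assoc minus_add a_ac)
  also have "\<dots> = \<ominus> (f j \<otimes> [c] \<cdot>\<^bsub>R\<^esub> P) \<oplus> (x \<otimes> ([c] \<cdot>\<^bsub>R\<^esub> P \<oplus> x \<otimes> s) \<oplus> \<ominus> (x \<otimes> (w \<otimes> s)))"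
    using closed by (simp add: w(2) m_assoc a_lcomm)
  also have "\<dots> = [(- c)] \<cdot>\<^bsub>R\<^esub> (f j \<otimes> P) \<oplus> x \<otimes> (([c] \<cdot>\<^bsub>R\<^esub> P \<oplus> x \<otimes> s) \<ominus> w \<otimes> s)"
    using closed
    by (simp add: int_add_pow_uminus add_pow_rdistr_int[OF y P] minus_eq r_distr r_minus)
  finally show ?case
    using closed by (auto simp: P_def[symmetric] eq c_def)
qed

text \<open>The main terms cancel and leave \<open>(x - y) x s = x x s - y x s\<close>, where both
  products have a left factor in the ideal.\<close>

lemma (in ideal) foldr_minus_mult_cong:
  assumes "x \<in> carrier R" "y \<in> carrier R" "P \<in> carrier R" "s \<in> carrier R"
    and "x \<otimes> x \<in> I" "y \<otimes> x \<in> I"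
  shows "(x \<ominus> y) \<otimes> ([(c :: int)] \<cdot>\<^bsub>R\<^esub> P \<oplus> x \<otimes> s) \<ominus> [c] \<cdot>\<^bsub>R\<^esub> (x \<otimes> P \<ominus> y \<otimes> P) \<in> I"
proof -
  note closed = assms(1-4) int_add_pow_closed[OF assms(3)]
  have "[c] \<cdot>\<^bsub>R\<^esub> (x \<otimes> P \<ominus> y \<otimes> P) = (x \<ominus> y) \<otimes> [c] \<cdot>\<^bsub>R\<^esub> P"
    using closed by (simp add: add_pow_rdistr_int minus_eq l_distr l_minus)
  then have "(x \<ominus> y) \<otimes> ([c] \<cdot>\<^bsub>R\<^esub> P \<oplus> x \<otimes> s) \<ominus> [c] \<cdot>\<^bsub>R\<^esub> (x \<otimes> P \<ominus> y \<otimes> P) = (x \<ominus> y) \<otimes> (x \<otimes> s)"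
    using closed by (simp add: r_distr minus_eq[of "_ \<oplus> _"] a_ac r_neg r_neg1)
  also have "\<dots> = x \<otimes> x \<otimes> s \<ominus> y \<otimes> x \<otimes> s"
    using closed by (simp add: minus_eq l_distr l_minus m_assoc)
  also have "\<dots> \<in> I"
    using assms by (simp add: minus_eq I_r_closed a_closed a_inv_closed)
  finally show ?thesis .
qed

lemma (in ring) foldr_mult_closed:
  "(\<And>j. j \<in> set js \<Longrightarrow> f j \<in> carrier R) \<Longrightarrow> foldr (\<lambda>j t. f j \<otimes> t) js \<one> \<in> carrier R"
  by (induction js) auto

lemma upt_2_Suc: "2 \<le> n \<Longrightarrow> [2..<Suc n] = 2 # [3..<Suc n]"
  by (simp add: upt_conv_Cons del: upt_Suc)

text \<open>The two ring lemmas are applied with \<open>x = a_1\<close>, \<open>y = a_2\<close> and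
  \<open>P = a_3 ... a_n\<close>: the first expands the factors from \<open>j = 3\<close> on, the
  second absorbs the error term after multiplication by \<open>a_1 - a_2\<close>.\<close>

lemma (in homogeneous_element) indicator_tensor_congruence:
  assumes n: "2 \<le> n" and I: "ideal I T"
    and sq: "indicator_tensor {1} \<otimes>\<^bsub>T\<^esub> indicator_tensor {1} \<in> I" and "indicator_tensor {1, 2} \<in> I"
  shows "foldr (\<lambda>j t. (indicator_tensor {1} \<ominus>\<^bsub>T\<^esub> indicator_tensor {j}) \<otimes>\<^bsub>T\<^esub> t) [2..<Suc n] \<one>\<^bsub>T\<^esub>
    \<ominus>\<^bsub>T\<^esub> [((-1 :: int) ^ n)] \<cdot>\<^bsub>T\<^esub> (indicator_tensor ({1} \<union> {3..n}) \<ominus>\<^bsub>T\<^esub> indicator_tensor {2..n}) \<in> I"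
proof -
  interpret I: ideal I T
    by fact
  note closed = indicator_tensor_carrier
  \<comment> \<open>The witness is \<open>a_j\<close> or its negative, according to the Koszul
    sign.\<close>
  have twist: "\<exists>w\<in>carrier T. indicator_tensor {j} \<otimes>\<^bsub>T\<^esub> indicator_tensor {1} = indicator_tensor {1} \<otimes>\<^bsub>T\<^esub> w"
    if "j > 1" for j
  proof -
    have "indicator_tensor {1, j} = indicator_tensor {1} \<otimes>\<^bsub>T\<^esub> indicator_tensor {j}"
      using indicator_tensor_mult_disjoint[of "{1}" "{j}"] that
      unfolding insert_is_Un[of 1 "{j}", symmetric] by simp
    with indicator_tensor_commute[OF that]
    have "indicator_tensor {j} \<otimes>\<^bsub>T\<^esub> indicator_tensor {1} = indicator_tensor {1} \<otimes>\<^bsub>T\<^esub> indicator_tensor {j}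
        \<or> indicator_tensor {j} \<otimes>\<^bsub>T\<^esub> indicator_tensor {1}
          = indicator_tensor {1} \<otimes>\<^bsub>T\<^esub> (\<ominus>\<^bsub>T\<^esub> indicator_tensor {j})"
      by (simp add: T.r_minus closed)
    then show ?thesis
      using closed by blast
  qed
  have P: "foldr (\<lambda>j t. indicator_tensor {j} \<otimes>\<^bsub>T\<^esub> t) [3..<Suc n] \<one>\<^bsub>T\<^esub> = indicator_tensor {3..n}"
    by (rule indicator_tensor_foldr) simp
  \<comment> \<open>The tail has \<open>n - 2\<close> factors, which has the parity of
    \<open>n\<close>; this is the sign in the congruence.\<close>
  have "length [3..<Suc n] + 2 = n"
    using n by (simp del: upt_Suc)
  then have "(-1 :: int) ^ n = (-1) ^ (length [3..<Suc n] + 2)"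
    by (simp only:)
  then have sign: "(-1 :: int) ^ length [3..<Suc n] = (-1) ^ n"
    by (simp add: power_add del: upt_Suc)
  from T.foldr_minus_mult[of "indicator_tensor {1}" "[3..<Suc n]" "\<lambda>j. indicator_tensor {j}"] closed twist
  obtain s where s: "s \<in> carrier T"
    and tail: "foldr (\<lambda>j t. (indicator_tensor {1} \<ominus>\<^bsub>T\<^esub> indicator_tensor {j}) \<otimes>\<^bsub>T\<^esub> t) [3..<Suc n] \<one>\<^bsub>T\<^esub>
      = [((-1 :: int) ^ n)] \<cdot>\<^bsub>T\<^esub> indicator_tensor {3..n} \<oplus>\<^bsub>T\<^esub> indicator_tensor {1} \<otimes>\<^bsub>T\<^esub> s"
    unfolding P sign by (auto simp del: upt_Suc)
  have "{2} \<union> {3..n} = {2..n}"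
    using n by auto
  then have "indicator_tensor {1} \<otimes>\<^bsub>T\<^esub> indicator_tensor {3..n} = indicator_tensor ({1} \<union> {3..n})"
    "indicator_tensor {2} \<otimes>\<^bsub>T\<^esub> indicator_tensor {3..n} = indicator_tensor {2..n}"
    using indicator_tensor_mult_disjoint[of "{1}" "{3..n}"]
      indicator_tensor_mult_disjoint[of "{2}" "{3..n}"] by auto
  \<comment> \<open>Up to sign this is the second generator of the ideal.\<close>
  moreover have "indicator_tensor {2} \<otimes>\<^bsub>T\<^esub> indicator_tensor {1} \<in> I"
    using indicator_tensor_commute[of 2] assms(4) by auto
  note I.foldr_minus_mult_cong[OF closed closed closed s sq this, of "(-1) ^ n" "{3..n}"]
  ultimately show ?thesis
    unfolding upt_2_Suc[OF n] foldr.simps comp_apply tail by simp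
qed

text \<open>Stated for an arbitrary ideal containing the two generators, with the right-hand side
  already expanded into pure tensors. The ring structure of the tensor power comes with the
  ideal.\<close>

lemma (in graded_space) tensor_congruence:
  fixes a :: 'h and d n :: nat
  defines "T \<equiv> tensor_power n A"
  assumes a: "homogeneous A d a" and one: "homogeneous A 0 \<one>\<^bsub>A\<^esub>"
    and one_mult: "\<And>b. b \<in> carrier A \<Longrightarrow> \<one>\<^bsub>A\<^esub> \<otimes>\<^bsub>A\<^esub> b \<in> carrier A \<Longrightarrow> \<one>\<^bsub>A\<^esub> \<otimes>\<^bsub>A\<^esub> b = b"
    and mult_one: "\<And>b. b \<in> carrier A \<Longrightarrow> b \<otimes>\<^bsub>A\<^esub> \<one>\<^bsub>A\<^esub> \<in> carrier A \<Longrightarrow> b \<otimes>\<^bsub>A\<^esub> \<one>\<^bsub>A\<^esub> = b"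
    and n: "2 \<le> n" and I: "ideal I T"
    and sq: "pure_tensor n A (\<lambda>i. if i = 1 then a \<otimes>\<^bsub>A\<^esub> a else \<one>\<^bsub>A\<^esub>) \<in> I"
    and prod: "pure_tensor n A (\<lambda>i. if i \<le> 2 then a else \<one>\<^bsub>A\<^esub>) \<in> I"
  shows "foldr (\<lambda>j t. (in_position n A a 1 \<ominus>\<^bsub>T\<^esub> in_position n A a j) \<otimes>\<^bsub>T\<^esub> t) [2..<Suc n] \<one>\<^bsub>T\<^esub>
    \<ominus>\<^bsub>T\<^esub> [((-1 :: int) ^ n)] \<cdot>\<^bsub>T\<^esub>
      (pure_tensor n A (\<lambda>i. if i \<in> {1} \<union> {3..n} then a else \<one>\<^bsub>A\<^esub>)
        \<ominus>\<^bsub>T\<^esub> pure_tensor n A (\<lambda>i. if i \<in> {2..n} then a else \<one>\<^bsub>A\<^esub>)) \<in> I"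
proof -
  interpret I: ideal I T
    by fact
  show ?thesis
  \<comment> \<open>The Koszul computation for \<open>a\<close> and \<open>1\<close> needs both to
    be nonzero. The degenerate case includes the empty space, where \<open>1 = 0\<close>.\<close>
  proof (cases "a = \<zero>\<^bsub>A\<^esub> \<or> \<one>\<^bsub>A\<^esub> = \<zero>\<^bsub>A\<^esub>")
    case True
    have entry: "(if Q then a else \<one>\<^bsub>A\<^esub>) \<in> carrier A" for Q
      using a one by (simp add: homogeneous_def)
    \<comment> \<open>A tensor with \<open>a\<close> in one position and \<open>1\<close> in another
      vanishes, whichever of the two is zero. This applies to \<open>a_1\<close>, to
      \<open>a_2\<close> and to both terms of the right-hand side.\<close>
    have zero: "pure_tensor n A (\<lambda>i. if Q i then a else \<one>\<^bsub>A\<^esub>) = \<zero>\<^bsub>T\<^esub>"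
      if "i \<in> {1..n}" "Q i" "j \<in> {1..n}" "\<not> Q j" for Q i j
      unfolding T_def using True
    proof
      assume "a = \<zero>\<^bsub>A\<^esub>"
      then show "pure_tensor n A (\<lambda>i. if Q i then a else \<one>\<^bsub>A\<^esub>) = \<zero>\<^bsub>tensor_power n A\<^esub>"
        by (intro pure_tensor_zero_entry[of _ _ i] entry) (use that in auto)
    next
      assume "\<one>\<^bsub>A\<^esub> = \<zero>\<^bsub>A\<^esub>"
      then show "pure_tensor n A (\<lambda>i. if Q i then a else \<one>\<^bsub>A\<^esub>) = \<zero>\<^bsub>tensor_power n A\<^esub>"
        by (intro pure_tensor_zero_entry[of _ _ j] entry) (use that in auto)
    qed
    have "in_position n A a 1 = \<zero>\<^bsub>T\<^esub>"
      "pure_tensor n A (\<lambda>i. if i \<in> {1} \<union> {3..n} then a else \<one>\<^bsub>A\<^esub>) = \<zero>\<^bsub>T\<^esub>"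
      unfolding in_position_def using n by (intro zero[where i = 1 and j = 2]; simp)+
    moreover have "in_position n A a 2 = \<zero>\<^bsub>T\<^esub>"
      "pure_tensor n A (\<lambda>i. if i \<in> {2..n} then a else \<one>\<^bsub>A\<^esub>) = \<zero>\<^bsub>T\<^esub>"
      unfolding in_position_def using n by (intro zero[where i = 2 and j = 1]; simp)+
    moreover have "in_position n A a j \<in> carrier T" for j
      unfolding in_position_def T_def by (rule pure_tensor_carrier(2)) (rule entry)
    \<comment> \<open>The leading factor \<open>a_1 - a_2\<close> is zero, so the remaining factors
      only have to lie in the carrier.\<close>
    then have "foldr (\<lambda>j t. (in_position n A a 1 \<ominus>\<^bsub>T\<^esub> in_position n A a j) \<otimes>\<^bsub>T\<^esub> t) [3..<Suc n] \<one>\<^bsub>T\<^esub>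
        \<in> carrier T"
      by (intro I.foldr_mult_closed) simp
    moreover have "[((-1 :: int) ^ n)] \<cdot>\<^bsub>T\<^esub> \<zero>\<^bsub>T\<^esub> = \<zero>\<^bsub>T\<^esub>"
      by (rule I.add.int_pow_one)
    ultimately show ?thesis
      unfolding upt_2_Suc[OF n] by (simp add: I.minus_eq del: upt_Suc)
  next
    case False
    interpret homogeneous_element A a d n
      by (intro homogeneous_element.intro homogeneous_element_axioms.intro graded_space_axioms)
        (use False a one one_mult mult_one I.ring_axioms in \<open>simp_all add: T_def\<close>)
    have "indicator_tensor {1, 2} \<in> I"
    proof -
      have "(\<lambda>i\<in>{1..n}. if i \<le> 2 then a else \<one>\<^bsub>A\<^esub>) = (\<lambda>i\<in>{1..n}. if i \<in> {1, 2} then a else \<one>\<^bsub>A\<^esub>)"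
        by (intro restrict_ext) auto
      with prod show ?thesis
        by (simp only: indicator_tensor_def pure_tensor_def)
    qed
    moreover have "indicator_tensor {1} \<otimes>\<^bsub>tensor_power n A\<^esub> indicator_tensor {1} \<in> I"
      using sq by (simp only: indicator_tensor_square)
    ultimately show ?thesis
      using indicator_tensor_congruence[OF n I[unfolded T_def]]
      by (simp only: in_position_eq indicator_tensor_def T_def)
  qed
qed

section \<open>The cohomology algebra\<close>

definition homogeneous_part :: "nat \<Rightarrow> ('a, 'k::field) cochain \<Rightarrow> ('a, 'k) cochain" where
  "homogeneous_part p c = (\<lambda>q f. if q = p then c q f else 0)"

lemma singular_cochains_add:
  assumes "c \<in> singular_cochains X" "d \<in> singular_cochains X"
  shows "(\<lambda>p f. c p f + d p f) \<in> singular_cochains X"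
proof -
  have "{p. \<exists>f. c p f + d p f \<noteq> 0} \<subseteq> {p. \<exists>f. c p f \<noteq> 0} \<union> {p. \<exists>f. d p f \<noteq> 0}"
    by auto
  then show ?thesis
    using assms by (auto simp: singular_cochains_def intro: finite_subset)
qed

lemma singular_cochains_scale:
  assumes "c \<in> singular_cochains X"
  shows "(\<lambda>p f. r * c p f) \<in> singular_cochains X"
proof -
  have "{p. \<exists>f. r * c p f \<noteq> 0} \<subseteq> {p. \<exists>f. c p f \<noteq> 0}"
    by auto
  then show ?thesis
    using assms by (auto simp: singular_cochains_def intro: finite_subset)
qed

lemma homogeneous_part_in_singular_cochains:
  assumes "c \<in> singular_cochains X"
  shows "homogeneous_part p c \<in> singular_cochains X"
proof -
  have "{q. \<exists>f. homogeneous_part p c q f \<noteq> 0} \<subseteq> {p}"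
    by (auto simp: homogeneous_part_def)
  then show ?thesis
    using assms by (auto simp: singular_cochains_def homogeneous_part_def intro: finite_subset)
qed

lemma singular_coboundary_add:
  "singular_coboundary X (\<lambda>p f. c p f + d p f)
    = (\<lambda>p f. singular_coboundary X c p f + singular_coboundary X d p f)"
  by (auto simp: singular_coboundary_def fun_eq_iff distrib_left sum.distrib)

lemma singular_coboundary_scale:
  "singular_coboundary X (\<lambda>p f. r * c p f) = (\<lambda>p f. r * singular_coboundary X c p f)"
  by (auto simp: singular_coboundary_def fun_eq_iff sum_distrib_left mult.left_commute)

text \<open>The coboundary raises degrees by one, so its part in degree \<open>p\<close> comes from
  degree \<open>p - 1\<close>. Degree 0 is separate: coboundaries vanish there, whereas truncated
  subtraction would give \<open>p - 1 = 0\<close>.\<close>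

lemma homogeneous_part_coboundary:
  "homogeneous_part p (singular_coboundary X c)
    = singular_coboundary X (if p = 0 then \<lambda>p f. 0 else homogeneous_part (p - 1) c)"
proof -
  have "q - 1 = p - 1 \<longleftrightarrow> q = p" if "0 < q" "0 < p" for q
    using that by auto
  then show ?thesis
    by (auto simp: singular_coboundary_def homogeneous_part_def fun_eq_iff)
qed

lemma singular_cocycles_add:
  "c \<in> singular_cocycles X \<Longrightarrow> d \<in> singular_cocycles X \<Longrightarrow> (\<lambda>p f. c p f + d p f) \<in> singular_cocycles X"
  by (simp add: singular_cocycles_def singular_cochains_add singular_coboundary_add)

lemma singular_cocycles_scale:
  "c \<in> singular_cocycles X \<Longrightarrow> (\<lambda>p f. r * c p f) \<in> singular_cocycles X"
  by (simp add: singular_cocycles_def singular_cochains_scale singular_coboundary_scale)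

lemma singular_coboundaries_add:
  assumes "c \<in> singular_coboundaries X" "d \<in> singular_coboundaries X"
  shows "(\<lambda>p f. c p f + d p f) \<in> singular_coboundaries X"
proof -
  obtain c' d' where "c' \<in> singular_cochains X" "d' \<in> singular_cochains X"
    "c = singular_coboundary X c'" "d = singular_coboundary X d'"
    using assms by (auto simp: singular_coboundaries_def)
  then show ?thesis
    unfolding singular_coboundaries_def
    by (intro image_eqI[OF _ singular_cochains_add[of c' X d']]) (simp_all add: singular_coboundary_add)
qed

lemma singular_coboundaries_scale:
  assumes "c \<in> singular_coboundaries X"
  shows "(\<lambda>p f. r * c p f) \<in> singular_coboundaries X"
proof -
  obtain c' where "c' \<in> singular_cochains X" "c = singular_coboundary X c'"
    using assms by (auto simp: singular_coboundaries_def)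
  then show ?thesis
    unfolding singular_coboundaries_def
    by (intro image_eqI[OF _ singular_cochains_scale[of c' X r]]) (simp_all add: singular_coboundary_scale)
qed

lemma zero_in_singular_cochains: "(\<lambda>p f. 0) \<in> singular_cochains X"
  by (simp add: singular_cochains_def)

lemma zero_in_singular_coboundaries: "(\<lambda>p f. 0) \<in> singular_coboundaries X"
  unfolding singular_coboundaries_def
  by (rule image_eqI[OF _ zero_in_singular_cochains]) (simp add: singular_coboundary_def fun_eq_iff)

text \<open>This makes the projections onto homogeneous parts well defined on cohomology.\<close>

lemma homogeneous_part_in_singular_coboundaries:
  assumes "c \<in> singular_coboundaries X"
  shows "homogeneous_part p c \<in> singular_coboundaries X"
proof -
  obtain c' where "c' \<in> singular_cochains X" "c = singular_coboundary X c'"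
    using assms by (auto simp: singular_coboundaries_def)
  then show ?thesis
    by (simp add: homogeneous_part_coboundary singular_coboundaries_def image_eqI
        zero_in_singular_cochains homogeneous_part_in_singular_cochains)
qed

section \<open>Cohomology classes and the operations on them\<close>

lemma cohomology_class_eq:
  "cohomology_class X z = {\<lambda>p f. b p f + z p f | b. b \<in> singular_coboundaries X}"
  by (auto simp: cohomology_class_def a_r_coset_def' cocycle_ring_def cochain_ring_def)

lemma cohomology_class_memI:
  "b \<in> singular_coboundaries X \<Longrightarrow> v = (\<lambda>p f. b p f + z p f) \<Longrightarrow> v \<in> cohomology_class X z"
  by (auto simp: cohomology_class_eq)

lemma cohomology_classE:
  assumes "v \<in> cohomology_class X z"
  obtains b where "b \<in> singular_coboundaries X" "v = (\<lambda>p f. b p f + z p f)"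
  using assms by (auto simp: cohomology_class_eq)

lemma self_in_cohomology_class: "z \<in> cohomology_class X z"
  by (rule cohomology_class_memI[OF zero_in_singular_coboundaries]) simp

lemma cohomology_class_eqI:
  fixes w z :: "('a, 'k::field) cochain"
  assumes "w \<in> cohomology_class X z"
  shows "cohomology_class X w = cohomology_class X z"
proof -
  obtain b where b: "b \<in> singular_coboundaries X" "w = (\<lambda>p f. b p f + z p f)"
    using assms by (rule cohomology_classE)
  have "cohomology_class X w \<subseteq> cohomology_class X z"
    unfolding cohomology_class_eq[of X w]
  proof safe
    fix e :: "('a, 'k) cochain" assume e: "e \<in> singular_coboundaries X"
    show "(\<lambda>p f. e p f + w p f) \<in> cohomology_class X z"
      by (rule cohomology_class_memI[OF singular_coboundaries_add[OF e b(1)]])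
        (simp add: b(2) add.assoc)
  qed
  moreover have "cohomology_class X z \<subseteq> cohomology_class X w"
    unfolding cohomology_class_eq[of X z]
  proof safe
    fix e :: "('a, 'k) cochain" assume e: "e \<in> singular_coboundaries X"
    show "(\<lambda>p f. e p f + z p f) \<in> cohomology_class X w"
      by (rule cohomology_class_memI[OF singular_coboundaries_add[OF e
            singular_coboundaries_scale[OF b(1), of "-1"]]]) (simp add: b(2))
  qed
  ultimately show ?thesis
    by (rule subset_antisym)
qed

lemma carrier_cohomology_algebra:
  "carrier (cohomology_algebra X) = cohomology_class X ` singular_cocycles X"
  by (auto simp: cohomology_algebra_def Let_def FactRing_def A_RCOSETS_def' cohomology_class_def
      cocycle_ring_def)

lemma zero_cohomology_algebra: "\<zero>\<^bsub>cohomology_algebra X\<^esub> = cohomology_class X (\<lambda>p f. 0)"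
  by (auto simp: cohomology_algebra_def Let_def FactRing_def cohomology_class_eq)

definition unit_cochain :: "'a topology \<Rightarrow> ('a, 'k::field) cochain" where
  "unit_cochain X = (\<lambda>p f. if p = 0 \<and> singular_simplex 0 X f then 1 else 0)"

lemma one_cohomology_algebra: "\<one>\<^bsub>cohomology_algebra X\<^esub> = cohomology_class X (unit_cochain X)"
  by (simp add: cohomology_algebra_def Let_def FactRing_def cohomology_class_def cocycle_ring_def
      cochain_ring_def unit_cochain_def)

lemma mult_cohomology_algebra:
  "A \<otimes>\<^bsub>cohomology_algebra X\<^esub> B = (\<Union>x\<in>A. \<Union>y\<in>B. cohomology_class X (cup_cochain X x y))"
  by (simp add: cohomology_algebra_def Let_def FactRing_def rcoset_mult_def cohomology_class_def
      cocycle_ring_def cochain_ring_def)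

lemma add_cohomology_class:
  "cohomology_class X z \<oplus>\<^bsub>cohomology_algebra X\<^esub> cohomology_class X w
    = cohomology_class X (\<lambda>p f. z p f + w p f)"
proof -
  have "cohomology_class X z \<oplus>\<^bsub>cohomology_algebra X\<^esub> cohomology_class X w
      = (\<Union>x\<in>cohomology_class X z. \<Union>y\<in>cohomology_class X w. {\<lambda>p f. x p f + y p f})"
    by (simp add: cohomology_algebra_def Let_def FactRing_def set_add_def' cocycle_ring_def
        cochain_ring_def)
  also have "\<dots> = cohomology_class X (\<lambda>p f. z p f + w p f)"
  proof (intro equalityI subsetI)
    fix v assume "v \<in> (\<Union>x\<in>cohomology_class X z. \<Union>y\<in>cohomology_class X w. {\<lambda>p f. x p f + y p f})"
    then obtain x y where x: "x \<in> cohomology_class X z" and y: "y \<in> cohomology_class X w"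
      and v: "v = (\<lambda>p f. x p f + y p f)"
      by blast
    from x obtain b where b: "b \<in> singular_coboundaries X" "x = (\<lambda>p f. b p f + z p f)"
      by (rule cohomology_classE)
    from y obtain c where c: "c \<in> singular_coboundaries X" "y = (\<lambda>p f. c p f + w p f)"
      by (rule cohomology_classE)
    show "v \<in> cohomology_class X (\<lambda>p f. z p f + w p f)"
      by (rule cohomology_class_memI[OF singular_coboundaries_add[OF b(1) c(1)]])
        (simp add: v b(2) c(2) ac_simps)
  next
    fix v assume "v \<in> cohomology_class X (\<lambda>p f. z p f + w p f)"
    then obtain b where b: "b \<in> singular_coboundaries X" "v = (\<lambda>p f. b p f + (z p f + w p f))"
      by (rule cohomology_classE)
    show "v \<in> (\<Union>x\<in>cohomology_class X z. \<Union>y\<in>cohomology_class X w. {\<lambda>p f. x p f + y p f})"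
      by (rule UN_I[OF cohomology_class_memI[OF b(1) refl] UN_I[OF self_in_cohomology_class]])
        (simp add: b(2) add.assoc)
  qed
  finally show ?thesis .
qed

text \<open>Multiples of coboundaries are coboundaries, so all representatives give the same class
  and the union defining \<open>smult\<close> is that class.\<close>

lemma smult_cohomology_class:
  "r \<odot>\<^bsub>cohomology_algebra X\<^esub> cohomology_class X z = cohomology_class X (\<lambda>p f. r * z p f)"
proof -
  have "cohomology_class X (\<lambda>p f. r * w p f) = cohomology_class X (\<lambda>p f. r * z p f)"
    if w: "w \<in> cohomology_class X z" for w
  proof -
    obtain b where b: "b \<in> singular_coboundaries X" "w = (\<lambda>p f. b p f + z p f)"
      using w by (rule cohomology_classE)
    show ?thesis
      by (intro cohomology_class_eqI cohomology_class_memI[OF singular_coboundaries_scale[OF b(1), of r]])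
        (simp add: b(2) distrib_left)
  qed
  then have "(\<Union>w\<in>cohomology_class X z. cohomology_class X (\<lambda>p f. r * w p f))
      = cohomology_class X (\<lambda>p f. r * z p f)"
    using self_in_cohomology_class[of z X] by blast
  then show ?thesis
    by (simp add: cohomology_algebra_def Let_def)
qed

lemma component_cohomology_class:
  "component (cohomology_algebra X) p (cohomology_class X z) = cohomology_class X (homogeneous_part p z)"
proof -
  have "cohomology_class X (homogeneous_part p w) = cohomology_class X (homogeneous_part p z)"
    if w: "w \<in> cohomology_class X z" for w
  proof -
    obtain b where b: "b \<in> singular_coboundaries X" "w = (\<lambda>p f. b p f + z p f)"
      using w by (rule cohomology_classE)
    have "homogeneous_part p w = (\<lambda>q f. homogeneous_part p b q f + homogeneous_part p z q f)"
      by (simp add: b(2) homogeneous_part_def fun_eq_iff)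
    then have "homogeneous_part p w \<in> cohomology_class X (homogeneous_part p z)"
      by (rule cohomology_class_memI[OF homogeneous_part_in_singular_coboundaries[OF b(1)]])
    then show ?thesis
      by (rule cohomology_class_eqI)
  qed
  then have "(\<Union>w\<in>cohomology_class X z. cohomology_class X (homogeneous_part p w))
      = cohomology_class X (homogeneous_part p z)"
    using self_in_cohomology_class[of z X] by blast
  then show ?thesis
    by (simp add: cohomology_algebra_def Let_def homogeneous_part_def)
qed

text \<open>A representative concentrated in degree \<open>d\<close> equals its own part in degree
  \<open>d\<close>, and its other parts are the zero cochain.\<close>

lemma homogeneous_cohomology_group:
  assumes "a \<in> cohomology_group X d"
  shows "homogeneous (cohomology_algebra X) d a"
proof -
  obtain z where z: "z \<in> singular_cocycles X" "\<forall>q f. q \<noteq> d \<longrightarrow> z q f = 0" "a = cohomology_class X z"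
    using assms by (auto simp: cohomology_group_def)
  then have "homogeneous_part p z = (if p = d then z else (\<lambda>p f. 0))" for p
    by (auto simp: homogeneous_part_def fun_eq_iff)
  with z show ?thesis
    by (simp add: homogeneous_def carrier_cohomology_algebra component_cohomology_class
        zero_cohomology_algebra)
qed

lemma graded_space_cohomology_algebra: "graded_space (cohomology_algebra X)"
  by unfold_locales
    (auto simp: carrier_cohomology_algebra add_cohomology_class smult_cohomology_class
      zero_cohomology_algebra singular_cocycles_add singular_cocycles_scale)

lemma one_in_cohomology_group:
  fixes X :: "'a topology"
  shows "(\<one>\<^bsub>cohomology_algebra X\<^esub> :: ('a, 'k::field) cochain set) \<in> cohomology_group X 0"
proof -
  let ?e = "unit_cochain X :: ('a, 'k) cochain"
  have "singular_coboundary X ?e p f = 0" for p f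
  proof (cases "p = 1 \<and> singular_simplex p X f")
    \<comment> \<open>On a 1-simplex both faces are 0-simplices, and their contributions
      \<open>1\<close> and \<open>-1\<close> cancel. In every other degree the unit cochain is
      evaluated in nonzero degree or the coboundary is 0 by definition.\<close>
    case True
    then have "singular_simplex 0 X (singular_face 1 i f)" if "i \<le> 1" for i
      using singular_simplex_singular_face[of p X f i] that by auto
    then show ?thesis
      using True by (simp add: singular_coboundary_def unit_cochain_def)
  next
    case False
    then show ?thesis
      by (auto simp: singular_coboundary_def unit_cochain_def le_Suc_eq intro!: sum.neutral)
  qed
  moreover have "{p. \<exists>f. ?e p f \<noteq> 0} \<subseteq> {0}"
    by (auto simp: unit_cochain_def)
  then have "?e \<in> singular_cochains X"
    by (auto simp: singular_cochains_def unit_cochain_def intro: finite_subset)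
  ultimately have "?e \<in> singular_cocycles X"
    by (simp add: singular_cocycles_def fun_eq_iff)
  then show ?thesis
    by (auto simp: cohomology_group_def one_cohomology_algebra unit_cochain_def)
qed

section \<open>The unit laws of the cup product\<close>

lemma singular_simplex_0_restrict:
  assumes "g v \<in> topspace X" "v = (\<lambda>j. if j = 0 then 1 else 0)"
  shows "singular_simplex 0 X (restrict g (standard_simplex 0))"
proof -
  \<comment> \<open>The standard 0-simplex is the single point \<open>v\<close>, and a map from a
    point into the space is continuous.\<close>
  have "continuous_map (subtopology (powertop_real UNIV) {v}) X (restrict g {v})"
    by (rule continuous_map_eq[of _ _ "\<lambda>_. g v"]) (use assms(1) in auto)
  then show ?thesis
    by (simp add: singular_simplex_def standard_simplex_0 assms(2))
qed

lemma singular_simplex_front_face_0: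
  assumes "singular_simplex n X f"
  shows "singular_simplex 0 X (front_face 0 f)"
proof -
  have "(\<lambda>j. if j = 0 then 1 else 0) \<in> standard_simplex n"
    using standard_simplex_mono[of 0 n] by (auto simp: standard_simplex_0)
  with assms have "f (\<lambda>j. if j = 0 then 1 else 0) \<in> topspace X"
    by (auto simp: singular_simplex_def continuous_map_def)
  then show ?thesis
    unfolding front_face_def by (rule singular_simplex_0_restrict[OF _ refl])
qed

lemma singular_simplex_back_face_0:
  assumes "singular_simplex n X f"
  shows "singular_simplex 0 X (back_face n 0 f)"
proof -
  \<comment> \<open>The vertex of the 0-simplex, shifted by \<open>n\<close> coordinates, is the
    last vertex of the \<open>n\<close>-simplex.\<close>
  have "(\<lambda>i. if i < n then 0 else if i - n = 0 then 1 else (0 :: real)) = (\<lambda>i. if i = n then 1 else 0)"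
    by auto
  then have "(\<lambda>i. if i < n then 0 else if i - n = 0 then 1 else 0) \<in> standard_simplex n"
    by (simp add: basis_in_standard_simplex)
  with assms have "f (\<lambda>i. if i < n then 0 else if i - n = 0 then 1 else 0) \<in> topspace X"
    by (auto simp: singular_simplex_def continuous_map_def)
  then show ?thesis
    unfolding back_face_def by (rule singular_simplex_0_restrict[OF _ refl])
qed

text \<open>Singular simplices are extensional, so restriction to the whole standard simplex changes
  nothing.\<close>

lemma front_face_full: "singular_simplex n X f \<Longrightarrow> front_face n f = f"
  by (auto simp: front_face_def singular_simplex_def extensional_restrict)

lemma back_face_full: "singular_simplex n X f \<Longrightarrow> back_face 0 n f = f"
  by (auto simp: back_face_def singular_simplex_def extensional_restrict)

text \<open>Only the term \<open>p = 0\<close> survives: there the unit cochain takes the value 1 at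
  the initial vertex, and the back face is the whole simplex. On the other side the surviving term
  is \<open>p = n\<close>.\<close>

lemma cup_unit_left:
  assumes "z \<in> singular_cochains X"
  shows "cup_cochain X (unit_cochain X) z = z"
proof (intro ext)
  fix n f
  have "(\<Sum>p\<le>n. unit_cochain X p (front_face p f) * z (n - p) (back_face p (n - p) f)) = z n f"
    if f: "singular_simplex n X f"
  proof -
    have "(\<Sum>p\<le>n. unit_cochain X p (front_face p f) * z (n - p) (back_face p (n - p) f))
        = (\<Sum>p\<in>{0}. unit_cochain X p (front_face p f) * z (n - p) (back_face p (n - p) f))"
      by (rule sum.mono_neutral_right) (auto simp: unit_cochain_def)
    then show ?thesis
      using f by (simp add: unit_cochain_def singular_simplex_front_face_0 back_face_full)
  qed
  \<comment> \<open>Away from singular simplices both sides are 0 by the normalisation of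
    cochains.\<close>
  then show "cup_cochain X (unit_cochain X) z n f = z n f"
    using assms by (auto simp: cup_cochain_def singular_cochains_def)
qed

lemma cup_unit_right:
  assumes "z \<in> singular_cochains X"
  shows "cup_cochain X z (unit_cochain X) = z"
proof (intro ext)
  fix n f
  have "(\<Sum>p\<le>n. z p (front_face p f) * unit_cochain X (n - p) (back_face p (n - p) f)) = z n f"
    if f: "singular_simplex n X f"
  proof -
    have "(\<Sum>p\<le>n. z p (front_face p f) * unit_cochain X (n - p) (back_face p (n - p) f))
        = (\<Sum>p\<in>{n}. z p (front_face p f) * unit_cochain X (n - p) (back_face p (n - p) f))"
      by (rule sum.mono_neutral_right) (auto simp: unit_cochain_def)
    then show ?thesis
      using f by (simp add: unit_cochain_def singular_simplex_back_face_0 front_face_full)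
  qed
  then show "cup_cochain X z (unit_cochain X) n f = z n f"
    using assms by (auto simp: cup_cochain_def singular_cochains_def)
qed

text \<open>As in the tensor power, membership in the carrier makes the union over representatives a
  single coset, which is determined by the product of the chosen ones.\<close>

lemma mult_cohomology_class:
  assumes "cohomology_class X z \<otimes>\<^bsub>cohomology_algebra X\<^esub> cohomology_class X w
    \<in> carrier (cohomology_algebra X)"
  shows "cohomology_class X z \<otimes>\<^bsub>cohomology_algebra X\<^esub> cohomology_class X w
    = cohomology_class X (cup_cochain X z w)"
proof -
  obtain v where v: "cohomology_class X z \<otimes>\<^bsub>cohomology_algebra X\<^esub> cohomology_class X w
      = cohomology_class X v"
    using assms by (auto simp: carrier_cohomology_algebra)
  have "cup_cochain X z w
      \<in> cohomology_class X z \<otimes>\<^bsub>cohomology_algebra X\<^esub> cohomology_class X w"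
    unfolding mult_cohomology_algebra using self_in_cohomology_class by blast
  then show ?thesis
    unfolding v by (rule cohomology_class_eqI[symmetric])
qed

lemma one_mult_cohomology_algebra:
  assumes "b \<in> carrier (cohomology_algebra X)"
    and "\<one>\<^bsub>cohomology_algebra X\<^esub> \<otimes>\<^bsub>cohomology_algebra X\<^esub> b \<in> carrier (cohomology_algebra X)"
  shows "\<one>\<^bsub>cohomology_algebra X\<^esub> \<otimes>\<^bsub>cohomology_algebra X\<^esub> b = b"
proof -
  obtain z where "z \<in> singular_cochains X" "b = cohomology_class X z"
    using assms(1) by (auto simp: carrier_cohomology_algebra singular_cocycles_def)
  then show ?thesis
    using assms(2) mult_cohomology_class[of X "unit_cochain X" z]
    by (simp add: one_cohomology_algebra cup_unit_left)
qed

lemma mult_one_cohomology_algebra: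
  assumes "b \<in> carrier (cohomology_algebra X)"
    and "b \<otimes>\<^bsub>cohomology_algebra X\<^esub> \<one>\<^bsub>cohomology_algebra X\<^esub> \<in> carrier (cohomology_algebra X)"
  shows "b \<otimes>\<^bsub>cohomology_algebra X\<^esub> \<one>\<^bsub>cohomology_algebra X\<^esub> = b"
proof -
  obtain z where "z \<in> singular_cochains X" "b = cohomology_class X z"
    using assms(1) by (auto simp: carrier_cohomology_algebra singular_cocycles_def)
  then show ?thesis
    using assms(2) mult_cohomology_class[of X z "unit_cochain X"]
    by (simp add: one_cohomology_algebra cup_unit_right)
qed

theorem lemma3p2:
  fixes X :: "'a topology" and a :: "('a, 'k::field) cochain set" and d n :: nat
  assumes "a \<in> cohomology_group X d" and "n \<ge> 2"
  shows "let H = cohomology_algebra X; T = tensor_power n H; T2 = tensor_power 2 H in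
    foldr (\<lambda>j t. (in_position n H a 1 \<ominus>\<^bsub>T\<^esub> in_position n H a j) \<otimes>\<^bsub>T\<^esub> t) [2..<Suc n] \<one>\<^bsub>T\<^esub>
      \<ominus>\<^bsub>T\<^esub> [((-1 :: int) ^ n)] \<cdot>\<^bsub>T\<^esub>
           juxtapose 2 (n - 2) H
             (pure_tensor 2 H (\<lambda>i. if i = 1 then a else \<one>\<^bsub>H\<^esub>)
                \<ominus>\<^bsub>T2\<^esub> pure_tensor 2 H (\<lambda>i. if i = 1 then \<one>\<^bsub>H\<^esub> else a))
             (pure_tensor (n - 2) H (\<lambda>i. a))
    \<in> Idl\<^bsub>T\<^esub> {pure_tensor n H (\<lambda>i. if i = 1 then a \<otimes>\<^bsub>H\<^esub> a else \<one>\<^bsub>H\<^esub>),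
             pure_tensor n H (\<lambda>i. if i \<le> 2 then a else \<one>\<^bsub>H\<^esub>)}"
proof -
  define H :: "('k, ('a, 'k) cochain set) graded_algebra" where "H = cohomology_algebra X"
  interpret graded_space H
    unfolding H_def by (rule graded_space_cohomology_algebra)
  have a: "homogeneous H d a" and one: "homogeneous H 0 \<one>\<^bsub>H\<^esub>"
    unfolding H_def using assms(1) one_in_cohomology_group by (blast intro: homogeneous_cohomology_group)+
  then have carrier: "a \<in> carrier H" "\<one>\<^bsub>H\<^esub> \<in> carrier H"
    by (simp_all add: homogeneous_def)
  have n: "2 + (n - 2) = n"
    using assms(2) by simp
  have tuple: "(\<lambda>i\<in>{1..n}. if i \<le> 2 then if i = 1 then a else \<one>\<^bsub>H\<^esub> else a)
      = (\<lambda>i\<in>{1..n}. if i \<in> {1} \<union> {3..n} then a else \<one>\<^bsub>H\<^esub>)"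
    "(\<lambda>i\<in>{1..n}. if i \<le> 2 then if i = 1 then \<one>\<^bsub>H\<^esub> else a else a)
      = (\<lambda>i\<in>{1..n}. if i \<in> {2..n} then a else \<one>\<^bsub>H\<^esub>)"
    by (intro restrict_ext; auto)+
  \<comment> \<open>In both tensors the entries from position 3 on are \<open>a\<close>, so each is
    described by its positions of \<open>a\<close>: all but 2 in the first, all but 1 in the second.
    For \<open>n = 2\<close> the right factor is the tensor of the empty tuple.\<close>
  have "juxtapose 2 (n - 2) H
      (pure_tensor 2 H (\<lambda>i. if i = 1 then a else \<one>\<^bsub>H\<^esub>)
        \<ominus>\<^bsub>tensor_power 2 H\<^esub> pure_tensor 2 H (\<lambda>i. if i = 1 then \<one>\<^bsub>H\<^esub> else a))
      (pure_tensor (n - 2) H (\<lambda>i. a))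
    = pure_tensor n H (\<lambda>i. if i \<in> {1} \<union> {3..n} then a else \<one>\<^bsub>H\<^esub>)
      \<ominus>\<^bsub>tensor_power n H\<^esub> pure_tensor n H (\<lambda>i. if i \<in> {2..n} then a else \<one>\<^bsub>H\<^esub>)"
    using carrier
    by (subst juxtapose_minus_pure_tensor) (auto simp only: n pure_tensor_def tuple split: if_splits)
  moreover have "\<one>\<^bsub>H\<^esub> \<otimes>\<^bsub>H\<^esub> b = b"
    if "b \<in> carrier H" "\<one>\<^bsub>H\<^esub> \<otimes>\<^bsub>H\<^esub> b \<in> carrier H" for b
    using that unfolding H_def by (rule one_mult_cohomology_algebra)
  moreover have "b \<otimes>\<^bsub>H\<^esub> \<one>\<^bsub>H\<^esub> = b"
    if "b \<in> carrier H" "b \<otimes>\<^bsub>H\<^esub> \<one>\<^bsub>H\<^esub> \<in> carrier H" for b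
    using that unfolding H_def by (rule mult_one_cohomology_algebra)
  \<comment> \<open>The generated ideal is an intersection, so membership is checked in each ideal
    containing the two generators.\<close>
  ultimately show ?thesis
    unfolding Let_def H_def[symmetric] genideal_def
    using tensor_congruence[OF a one _ _ assms(2)] by auto
qed

end
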